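(* Let $n\ge 1$, let $\alpha$ satisfy Hypothesis (H) of the context, let $g:[0,\infty)^n\to\mathbb{R}$ be continuous and of at most polynomial growth, and let $u$ be the solution of the Black-Scholes equation with initial condition $g$ (as defined in the context). Assume that there are constants $C>0$ and $\beta\in[0,2)$ such that $$a_{11}(x_1,t)\ge C x_1^{\beta}\qquad\text{for all } x_1>0 \text{ and all } t.$$ Let $P'=(0,x_2',\dots,x_n',t_0)$ with $t_0>0$ and $x_i'>0$ for $i=2,\dots,n$. Assume that in some neighborhood of $P'$ we have $$u(x_1,x_2,\dots,x_n,t)>u(0,x_2,\dots,x_n,t)$$ for all points $(x_1,\dots,x_n,t)$ with $x_1>0$ and $t\le t_0$. Then $u_{x_1}(P')>0$ in the sense that $$\liminf_{\epsilon\downarrow 0}\frac{1}{\epsilon}\Big(u(P'+\epsilon e_1)-u(P')\Big)>0,$$ where $e_1$ is the unit vector in the $x_1$-direction.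
   Context: Fix $T\in\mathbb{R}$. Hypothesis (H). The $n\times n$ matrix $\alpha=(\alpha_{ij}(x,t))_{i,j=1}^n$ is defined on $[0,\infty)^n\times(-\infty,T]$ and: (i) $\alpha$ is continuous in the time variable, and is Lipschitz continuous in the spatial variables on every compact subset of $(0,\infty)^n\times(-\infty,T]$; moreover $|\alpha(x,t)|\le K(1+|x|)$ for some constant $K$; (ii) for each pair $(i,j)$, $\alpha_{ij}$ is a function of $x_i$ and $t$ only, and $\alpha_{ij}=0$ when $x_i=0$; (iii) at each point $(x,t)$ the rank of $\alpha(x,t)$ equals the number of non-zero coordinates of $x$. If $n=1$, the local Lipschitz condition in (i) may be replaced with a local Hölder(1/2) condition. Discontinuities of $\alpha$ at the spatial boundary (where some $x_i=0$) are allowed. For $t\ge 0$ set $a(x,t)=(a_{ij}(x,t))_{i,j=1}^n:=\tfrac12\alpha(x,T-t)\alpha^*(x,T-t)$. By (ii), $a_{ij}$ depends only on $x_i,x_j,t$; in particular $a_{11}=a_{11}(x_1,t)$. Black-Scholes equation. $u$ solves $$\mathcal{L}u:=\sum_{i,j=1}^n a_{ij}u_{x_ix_j}-u_t=0\ \text{ in }(0,\infty)^n\times(0,\infty),\qquad u(x,0)=g(x),$$ with boundary conditions at the faces $\{x_i=0\}$ defined inductively by solving the equation in lower-dimensional faces: at $x=0$ one has $u_t=0$, i.e. $u(0,t)=g(0)$; and for each face of $[0,\infty)^n$ obtained by setting some of the coordinates equal to $0$, the restriction of $u$ to that face solves the corresponding equation $\sum a_{ij}u_{x_ix_j}-u_t=0$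 (sum over the non-zero coordinates only) in the relative interior of the face for $t>0$, with initial condition $g$ restricted to that face. It is known that there is a unique classical solution of at most polynomial growth (i.e. continuous on $[0,\infty)^n\times[0,\infty)$, twice continuously differentiable in space and once in time in the relative interior of each face for $t>0$, and of at most polynomial growth in $x$ uniformly on bounded time intervals); this is the function $u$. *)

theory Defs
  imports "HOL-Analysis.Analysis"
begin

text \<open>
  The space dimension is \<open>CARD('n)\<close>. Functions that the mathematics defines only for
  \<open>x\<close> in the closed orthant, or only for part of the time axis, are total here, and every
  condition on them is restricted to the intended domain.
\<close>

definition orthant :: "(real ^ 'n) set" where
  "orthant = {x. \<forall>i. 0 \<le> x $ i}"

text \<open>The relative interior of the face whose non-zero coordinates are those in \<open>S\<close>:
  \<open>S = UNIV\<close> gives the open orthant and \<open>S = {}\<close> the origin.\<close>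

definition open_face :: "'n set \<Rightarrow> (real ^ 'n) set" where
  "open_face S = {x. (\<forall>i\<in>S. 0 < x $ i) \<and> (\<forall>i. i \<notin> S \<longrightarrow> x $ i = 0)}"

definition poly_growth :: "(real ^ 'n \<Rightarrow> real) \<Rightarrow> bool" where
  "poly_growth g \<longleftrightarrow> (\<exists>M p. \<forall>x\<in>orthant. \<bar>g x\<bar> \<le> M * (1 + norm x) ^ p)"

text \<open>Hoelder continuity with exponent \<open>\<gamma>\<close> in the spatial variables, on every compact subset
  of \<open>(0,\<infinity>)\<^sup>n \<times> (-\<infinity>,T]\<close>, uniformly in time on that subset; \<open>\<gamma> = 1\<close> is the Lipschitz condition.\<close>

definition locally_holder_in_space ::
  "real \<Rightarrow> real \<Rightarrow> (real ^ 'n \<Rightarrow> real \<Rightarrow> real ^ 'n ^ 'n) \<Rightarrow> bool" where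
  "locally_holder_in_space \<gamma> T \<alpha> \<longleftrightarrow>
    (\<forall>Q. compact Q \<and> Q \<subseteq> open_face UNIV \<times> {..T} \<longrightarrow>
      (\<exists>L. \<forall>x y t. (x, t) \<in> Q \<and> (y, t) \<in> Q \<longrightarrow>
        norm (\<alpha> x t - \<alpha> y t) \<le> L * norm (x - y) powr \<gamma>))"

text \<open>The norm of a matrix is the Euclidean (Frobenius) norm. No regularity in \<open>x\<close> is required
  at the spatial boundary.\<close>

definition hypothesis_H ::
  "real \<Rightarrow> (real ^ 'n \<Rightarrow> real \<Rightarrow> real ^ 'n ^ 'n) \<Rightarrow> bool" where
  "hypothesis_H T \<alpha> \<longleftrightarrow>
    (\<forall>x\<in>orthant. continuous_on {..T} (\<alpha> x)) \<and>
    (locally_holder_in_space 1 T \<alpha> \<or>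
      CARD('n) = 1 \<and> locally_holder_in_space (1/2) T \<alpha>) \<and>
    (\<exists>K. \<forall>x\<in>orthant. \<forall>t\<le>T. norm (\<alpha> x t) \<le> K * (1 + norm x)) \<and>
    (\<forall>i j. \<forall>x\<in>orthant. \<forall>y\<in>orthant. \<forall>t\<le>T.
      x $ i = y $ i \<longrightarrow> \<alpha> x t $ i $ j = \<alpha> y t $ i $ j) \<and>
    (\<forall>i j. \<forall>x\<in>orthant. \<forall>t\<le>T. x $ i = 0 \<longrightarrow> \<alpha> x t $ i $ j = 0) \<and>
    (\<forall>x\<in>orthant. \<forall>t\<le>T. rank (\<alpha> x t) = card {i. x $ i \<noteq> 0})"

text \<open>The argument \<open>t\<close> is time to maturity, whence the time reversal.\<close>

definition diffusion ::
  "real \<Rightarrow> (real ^ 'n \<Rightarrow> real \<Rightarrow> real ^ 'n ^ 'n) \<Rightarrow> real ^ 'n \<Rightarrow> real \<Rightarrow> real ^ 'n ^ 'n" where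
  "diffusion T \<alpha> x t = (1/2) *\<^sub>R (\<alpha> x (T - t) ** transpose (\<alpha> x (T - t)))"

text \<open>The restriction of \<open>u\<close> to \<open>open_face S \<times> (0,\<infinity>)\<close> has first and second spatial partial
  derivatives \<open>ux i\<close>, \<open>uxx i j\<close> along the face and time derivative \<open>ut\<close>, all jointly continuous.
  The curves \<open>x + s e\<^sub>i\<close> with \<open>i \<in> S\<close> stay in \<open>open_face S\<close> for small \<open>\<bar>s\<bar>\<close>.\<close>

definition C21_on_face ::
  "'n set \<Rightarrow> (real ^ 'n \<Rightarrow> real \<Rightarrow> real) \<Rightarrow> ('n \<Rightarrow> real ^ 'n \<Rightarrow> real \<Rightarrow> real) \<Rightarrow>
    ('n \<Rightarrow> 'n \<Rightarrow> real ^ 'n \<Rightarrow> real \<Rightarrow> real) \<Rightarrow> (real ^ 'n \<Rightarrow> real \<Rightarrow> real) \<Rightarrow> bool" where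
  "C21_on_face S u ux uxx ut \<longleftrightarrow>
    (\<forall>x\<in>open_face S. \<forall>t>0.
      (\<forall>i\<in>S. ((\<lambda>s. u (x + s *\<^sub>R axis i 1) t) has_real_derivative ux i x t) (at 0)) \<and>
      (\<forall>i\<in>S. \<forall>j\<in>S.
        ((\<lambda>s. ux i (x + s *\<^sub>R axis j 1) t) has_real_derivative uxx i j x t) (at 0)) \<and>
      (u x has_real_derivative ut x t) (at t)) \<and>
    (\<forall>i\<in>S. continuous_on (open_face S \<times> {0<..}) (\<lambda>(x, t). ux i x t)) \<and>
    (\<forall>i\<in>S. \<forall>j\<in>S. continuous_on (open_face S \<times> {0<..}) (\<lambda>(x, t). uxx i j x t)) \<and>
    continuous_on (open_face S \<times> {0<..}) (\<lambda>(x, t). ut x t)"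

text \<open>Classical solution of at most polynomial growth. The equation is required on every face;
  on the face \<open>S = {}\<close> the sum is empty and the equation reads \<open>u\<^sub>t = 0\<close> at the origin.\<close>

definition black_scholes_solution ::
  "real \<Rightarrow> (real ^ 'n \<Rightarrow> real \<Rightarrow> real ^ 'n ^ 'n) \<Rightarrow> (real ^ 'n \<Rightarrow> real) \<Rightarrow>
    (real ^ 'n \<Rightarrow> real \<Rightarrow> real) \<Rightarrow> bool" where
  "black_scholes_solution T \<alpha> g u \<longleftrightarrow>
    continuous_on (orthant \<times> {0..}) (\<lambda>(x, t). u x t) \<and>
    (\<forall>\<tau>. \<exists>M p. \<forall>x\<in>orthant. \<forall>t\<in>{0..\<tau>}. \<bar>u x t\<bar> \<le> M * (1 + norm x) ^ p) \<and>
    (\<forall>x\<in>orthant. u x 0 = g x) \<and>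
    (\<forall>S. \<exists>ux uxx ut. C21_on_face S u ux uxx ut \<and>
      (\<forall>x\<in>open_face S. \<forall>t>0.
        (\<Sum>i\<in>S. \<Sum>j\<in>S. diffusion T \<alpha> x t $ i $ j * uxx i j x t) - ut x t = 0))"

end

theory Submission
  imports Defs
begin

text \<open>
  The excess \<open>w(x, t) = u(x, t) - u(x\<^sub>1 = 0, t)\<close> solves the equation, vanishes on the face and is
  positive near \<open>P'\<close>. As in Hopf's boundary point lemma, \<open>w\<close> is compared with a strict subsolution
  on a small cylinder of height \<open>\<delta>\<close> over the face:
  \<open>h = x\<^sub>1 (1 - 2 q / r\<^sup>2 - 2 (t\<^sub>0 - t) / r) + A x\<^sub>1\<^bsup>1+\<kappa>\<^esup>\<close>, where \<open>q\<close> is the squared distance to \<open>P'\<close>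
  along the face and \<open>\<kappa> = 1 - \<beta>/2 > 0\<close>. For \<open>A \<delta>\<^bsup>\<kappa>\<^esup> \<le> 1\<close> one has \<open>h \<le> 0\<close> on the lateral and initial
  boundary even where \<open>w\<close> degenerates, so \<open>w \<ge> c h\<close>
  by the minimum principle, and \<open>h \<ge> \<epsilon>\<close> at \<open>P' + \<epsilon> e\<^sub>1\<close>.
\<close>

section \<open>Second-order conditions at a minimum\<close>

text \<open>\<open>C21_on_face\<close> supplies derivatives along the axes only, while the
  second-order test below needs arbitrary directions. Moving one coordinate at a time and using the
  mean value inequality on each segment turns continuity of the partials into total
  differentiability.\<close>

lemma has_derivative_of_continuous_partials:
  fixes f :: "real ^ 'n \<Rightarrow> real"
  assumes "open V" "z \<in> V"
    and der: "\<And>x i. x \<in> V \<Longrightarrow> ((\<lambda>s. f (x + s *\<^sub>R axis i 1)) has_real_derivative D i x) (at 0)"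
    and cont: "\<And>i. continuous_on V (D i)"
  shows "(f has_derivative (\<lambda>h. \<Sum>i\<in>UNIV. h $ i * D i z)) (at z)"
  unfolding has_derivative_at_alt
proof (intro conjI allI impI)
  show "bounded_linear (\<lambda>h. \<Sum>i\<in>UNIV. h $ i * D i z)"
    by (intro bounded_linear_sum bounded_linear_mult_const bounded_linear_vec_nth)
  fix e :: real
  assume "e > 0"
  \<comment> \<open>The error below is \<open>\<eta>\<close> times a sum of \<open>CARD('n)\<close>
    components, each at most the norm of the displacement.\<close>
  define \<eta> where "\<eta> = e / CARD('n)"
  have "\<eta> > 0"
    unfolding \<eta>_def using \<open>e > 0\<close> by simp
  have "\<forall>\<^sub>F y in nhds z. \<bar>D i y - D i z\<bar> < \<eta>" for i
  proof -
    have "isCont (D i) z"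
      using cont assms(1,2) continuous_on_eq_continuous_at by blast
    then have "(D i \<longlongrightarrow> D i z) (nhds z)"
      by (simp add: continuous_at tendsto_at_iff_tendsto_nhds)
    then show ?thesis
      using tendstoD[of "D i" "D i z" "nhds z" \<eta>] \<open>\<eta> > 0\<close> by (simp add: dist_real_def)
  qed
  then have "\<forall>\<^sub>F y in nhds z. \<forall>i. \<bar>D i y - D i z\<bar> < \<eta>"
    by (simp add: eventually_all_finite)
  moreover have "\<forall>\<^sub>F y in nhds z. y \<in> V"
    using assms(1,2) eventually_nhds by blast
  ultimately have "\<forall>\<^sub>F y in nhds z. y \<in> V \<and> (\<forall>i. \<bar>D i y - D i z\<bar> < \<eta>)"
    by (simp add: eventually_conj_iff)
  then obtain d where "d > 0"
    and d: "\<And>y. dist y z < d \<Longrightarrow> y \<in> V \<and> (\<forall>i. \<bar>D i y - D i z\<bar> < \<eta>)"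
    unfolding eventually_nhds_metric by blast
  \<comment> \<open>\<open>I\<close> collects the coordinates already moved; the induction adds one
    at a time, and \<open>I = UNIV\<close> gives the estimate sought.\<close>
  have part: "\<bar>f (z + (\<chi> i. if i \<in> I then h $ i else 0)) - f z - (\<Sum>i\<in>I. h $ i * D i z)\<bar>
      \<le> \<eta> * (\<Sum>i\<in>I. \<bar>h $ i\<bar>)" if "norm h < d" for h I
  proof -
    have "finite I"
      by simp
    then show ?thesis
    proof (induction I rule: finite_induct)
      case empty
      then show ?case
        by (simp add: zero_vec_def[symmetric])
    next
      case (insert j I)
      define p where "p = z + (\<chi> i. if i \<in> I then h $ i else 0)"
      \<comment> \<open>With the slope \<open>D j z\<close> subtracted, the derivative of
        \<open>\<phi>\<close> is the deviation of \<open>D j\<close> from its value at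
        \<open>z\<close>, which is at most \<open>\<eta>\<close> in absolute value near
        \<open>z\<close>.\<close>
      define \<phi> where "\<phi> s = f (p + s *\<^sub>R axis j 1) - s * D j z" for s
      have pj: "z + (\<chi> i. if i \<in> insert j I then h $ i else 0) = p + h $ j *\<^sub>R axis j 1"
        using insert.hyps by (auto simp: p_def vec_eq_iff axis_def)
      \<comment> \<open>As \<open>j\<close> is not in \<open>I\<close>, no component of the
        displacement from \<open>z\<close> exceeds that of \<open>h\<close>, so the intermediate
        points stay in the ball.\<close>
      have near: "dist (p + s *\<^sub>R axis j 1) z < d" if s: "s \<in> closed_segment 0 (h $ j)" for s
      proof -
        have "\<bar>s\<bar> \<le> \<bar>h $ j\<bar>"
          using s by (auto simp: closed_segment_eq_real_ivl split: if_splits)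
        then have "norm ((p + s *\<^sub>R axis j 1) - z) \<le> norm h"
          using insert.hyps by (intro norm_le_componentwise_cart) (auto simp: p_def axis_def)
        then show ?thesis
          using \<open>norm h < d\<close> by (simp add: dist_norm)
      qed
      have "(\<phi> has_real_derivative D j (p + s *\<^sub>R axis j 1) - D j z)
          (at s within closed_segment 0 (h $ j))" if s: "s \<in> closed_segment 0 (h $ j)" for s
      proof -
        have "((\<lambda>r. f ((p + s *\<^sub>R axis j 1) + r *\<^sub>R axis j 1)) has_real_derivative
            D j (p + s *\<^sub>R axis j 1)) (at 0)"
          using der near[OF s] d by blast
        then have "((\<lambda>r. f (p + (r + s) *\<^sub>R axis j 1)) has_real_derivative
            D j (p + s *\<^sub>R axis j 1)) (at 0)"
          by (simp add: algebra_simps)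
        then have "((\<lambda>r. f (p + r *\<^sub>R axis j 1)) has_real_derivative
            D j (p + s *\<^sub>R axis j 1)) (at s)"
          using DERIV_at_within_shift[of "\<lambda>r. f (p + r *\<^sub>R axis j 1)" _ s 0 UNIV]
          by (simp add: add.commute)
        then have "(\<phi> has_real_derivative D j (p + s *\<^sub>R axis j 1) - D j z) (at s)"
          unfolding \<phi>_def by (auto intro!: derivative_eq_intros)
        then show ?thesis
          by (rule has_field_derivative_at_within)
      qed
      moreover have "norm (D j (p + s *\<^sub>R axis j 1) - D j z) \<le> \<eta>"
        if s: "s \<in> closed_segment 0 (h $ j)" for s
        using d[OF near[OF s]] by (auto intro: less_imp_le)
      ultimately have "norm (\<phi> (h $ j) - \<phi> 0) \<le> \<eta> * norm (h $ j - 0)"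
        by (intro field_differentiable_bound[of "closed_segment 0 (h $ j)"]) auto
      then have "\<bar>f (p + h $ j *\<^sub>R axis j 1) - f p - h $ j * D j z\<bar> \<le> \<eta> * \<bar>h $ j\<bar>"
        by (simp add: \<phi>_def)
      moreover have "\<bar>f p - f z - (\<Sum>i\<in>I. h $ i * D i z)\<bar> \<le> \<eta> * (\<Sum>i\<in>I. \<bar>h $ i\<bar>)"
        using insert.IH by (simp add: p_def)
      moreover have "(\<Sum>i\<in>insert j I. h $ i * D i z) = h $ j * D j z + (\<Sum>i\<in>I. h $ i * D i z)"
        "\<eta> * (\<Sum>i\<in>insert j I. \<bar>h $ i\<bar>) = \<eta> * \<bar>h $ j\<bar> + \<eta> * (\<Sum>i\<in>I. \<bar>h $ i\<bar>)"
        using insert.hyps by (simp_all add: algebra_simps)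
      ultimately show ?case
        unfolding pj by linarith
    qed
  qed
  have "norm (f y - f z - (\<Sum>i\<in>UNIV. (y - z) $ i * D i z)) \<le> e * norm (y - z)"
    if "norm (y - z) < d" for y
  proof -
    have "(\<chi> i. if i \<in> UNIV then (y - z) $ i else 0) = y - z"
      by (simp add: vec_eq_iff)
    then have "\<bar>f y - f z - (\<Sum>i\<in>UNIV. (y - z) $ i * D i z)\<bar> \<le> \<eta> * (\<Sum>i\<in>UNIV. \<bar>(y - z) $ i\<bar>)"
      using part[OF that, of UNIV] by (simp del: vector_minus_component)
    also have "\<dots> \<le> \<eta> * (\<Sum>i\<in>(UNIV :: 'n set). norm (y - z))"
      using \<open>\<eta> > 0\<close> by (intro mult_left_mono sum_mono component_le_norm_cart) auto
    also have "\<dots> = e * norm (y - z)"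
      by (simp add: \<eta>_def)
    finally show ?thesis
      by simp
  qed
  then show "\<exists>d>0. \<forall>y. norm (y - z) < d \<longrightarrow>
      norm (f y - f z - (\<Sum>i\<in>UNIV. (y - z) $ i * D i z)) \<le> e * norm (y - z)"
    using \<open>d > 0\<close> by blast
qed

text \<open>If \<open>l\<close> were negative, \<open>\<phi>'\<close>, which vanishes at the
  minimum, would be negative immediately to its right, and \<open>\<phi>\<close> would drop below
  its minimum.\<close>

lemma DERIV_second_nonneg_at_min:
  fixes \<phi> :: "real \<Rightarrow> real"
  assumes "d > 0"
    and der: "\<And>s. \<bar>s\<bar> < d \<Longrightarrow> (\<phi> has_real_derivative \<phi>' s) (at s)"
    and der2: "(\<phi>' has_real_derivative l) (at 0)"
    and min: "\<And>s. \<bar>s\<bar> < d \<Longrightarrow> \<phi> 0 \<le> \<phi> s"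
  shows "0 \<le> l"
proof (rule ccontr)
  assume "\<not> 0 \<le> l"
  then obtain d' where "d' > 0" and d': "\<And>h. 0 < h \<Longrightarrow> h < d' \<Longrightarrow> \<phi>' h < \<phi>' 0"
    using DERIV_neg_dec_right[OF der2] by auto
  have "\<phi>' 0 = 0"
    using DERIV_local_min[OF der[of 0] \<open>d > 0\<close>] min \<open>d > 0\<close> by simp
  define h where "h = min d d' / 2"
  have h: "0 < h" "h < d" "h < d'"
    using \<open>d > 0\<close> \<open>d' > 0\<close> by (auto simp: h_def)
  have "\<phi> 0 > \<phi> h"
  proof (rule DERIV_neg_imp_decreasing_open[OF h(1)])
    show "\<exists>y. DERIV \<phi> x :> y \<and> y < 0" if "0 < x" "x < h" for x
      using der[of x] d'[of x] \<open>\<phi>' 0 = 0\<close> that h by auto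
    show "continuous_on {0..h} \<phi>"
    proof (rule DERIV_atLeastAtMost_imp_continuous_on)
      show "\<exists>y. DERIV \<phi> x :> y" if "0 \<le> x" "x \<le> h" for x
        using der[of x] that h by auto
    qed
  qed
  then show False
    using min[of h] h by simp
qed

text \<open>Along the line through \<open>z\<close> in direction \<open>\<xi>\<close> the
  one-dimensional test applies. The chain rule is needed twice, for \<open>f\<close> and for each
  \<open>D i\<close>, hence the generic \<open>F\<close> and \<open>G\<close> in the auxiliary fact
  \<open>line\<close>.\<close>

lemma second_derivative_nonneg_at_min:
  fixes f :: "real ^ 'n \<Rightarrow> real"
  assumes "open V" "z \<in> V"
    and der: "\<And>x i. x \<in> V \<Longrightarrow> ((\<lambda>s. f (x + s *\<^sub>R axis i 1)) has_real_derivative D i x) (at 0)"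
    and cont: "\<And>i. continuous_on V (D i)"
    and der2: "\<And>x i j. x \<in> V \<Longrightarrow>
      ((\<lambda>s. D i (x + s *\<^sub>R axis j 1)) has_real_derivative D2 i j x) (at 0)"
    and cont2: "\<And>i j. continuous_on V (D2 i j)"
    and min: "\<And>x. x \<in> V \<Longrightarrow> f z \<le> f x"
  shows "0 \<le> (\<Sum>i\<in>UNIV. \<Sum>j\<in>UNIV. \<xi> $ i * \<xi> $ j * D2 i j z)"
proof -
  have line: "((\<lambda>s. F (z + s *\<^sub>R \<xi>)) has_real_derivative (\<Sum>i\<in>UNIV. \<xi> $ i * G i (z + s *\<^sub>R \<xi>))) (at s)"
    if "z + s *\<^sub>R \<xi> \<in> V"
      and F: "\<And>x i. x \<in> V \<Longrightarrow> ((\<lambda>s. F (x + s *\<^sub>R axis i 1)) has_real_derivative G i x) (at 0)"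
      and G: "\<And>i. continuous_on V (G i)"
    for s and F :: "real ^ 'n \<Rightarrow> real" and G
  proof -
    have "(F has_derivative (\<lambda>h. \<Sum>i\<in>UNIV. h $ i * G i (z + s *\<^sub>R \<xi>))) (at (z + s *\<^sub>R \<xi>))"
      by (rule has_derivative_of_continuous_partials[OF \<open>open V\<close> that])
    moreover have "((\<lambda>s. z + s *\<^sub>R \<xi>) has_derivative (\<lambda>r. r *\<^sub>R \<xi>)) (at s)"
      by (auto intro!: derivative_eq_intros)
    ultimately have "((\<lambda>s. F (z + s *\<^sub>R \<xi>)) has_derivative
        (\<lambda>r. \<Sum>i\<in>UNIV. (r *\<^sub>R \<xi>) $ i * G i (z + s *\<^sub>R \<xi>))) (at s)"
      using has_derivative_compose by fastforce
    then show ?thesis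
      by (rule has_derivative_imp_has_field_derivative) (simp add: sum_distrib_left mult_ac)
  qed
  have "isCont (\<lambda>s. z + s *\<^sub>R \<xi>) 0"
    by (intro continuous_intros)
  then have "\<forall>\<^sub>F s in nhds 0. z + s *\<^sub>R \<xi> \<in> V"
    using assms(1,2) continuous_at_open[of "0::real" "\<lambda>s. z + s *\<^sub>R \<xi>"]
    unfolding eventually_nhds by fastforce
  then obtain d where "d > 0" and d: "\<And>s. \<bar>s\<bar> < d \<Longrightarrow> z + s *\<^sub>R \<xi> \<in> V"
    unfolding eventually_nhds_metric by (auto simp: dist_real_def)
  have "0 \<le> (\<Sum>i\<in>UNIV. \<xi> $ i * (\<Sum>j\<in>UNIV. \<xi> $ j * D2 i j (z + 0 *\<^sub>R \<xi>)))"
  proof (rule DERIV_second_nonneg_at_min[OF \<open>d > 0\<close>])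
    show "((\<lambda>s. f (z + s *\<^sub>R \<xi>)) has_real_derivative (\<Sum>i\<in>UNIV. \<xi> $ i * D i (z + s *\<^sub>R \<xi>))) (at s)"
      if "\<bar>s\<bar> < d" for s
      using line[OF d[OF that] der cont] by simp
    have "((\<lambda>s. D i (z + s *\<^sub>R \<xi>)) has_real_derivative
        (\<Sum>j\<in>UNIV. \<xi> $ j * D2 i j (z + 0 *\<^sub>R \<xi>))) (at 0)" for i
      using line[OF d der2 cont2, of 0 i] \<open>d > 0\<close> by simp
    then show "((\<lambda>s. \<Sum>i\<in>UNIV. \<xi> $ i * D i (z + s *\<^sub>R \<xi>)) has_real_derivative
        (\<Sum>i\<in>UNIV. \<xi> $ i * (\<Sum>j\<in>UNIV. \<xi> $ j * D2 i j (z + 0 *\<^sub>R \<xi>)))) (at 0)"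
      by (intro DERIV_sum DERIV_cmult)
    show "f (z + 0 *\<^sub>R \<xi>) \<le> f (z + s *\<^sub>R \<xi>)" if "\<bar>s\<bar> < d" for s
      using min d[OF that] by simp
  qed
  then show ?thesis
    by (simp add: sum_distrib_left mult.assoc)
qed

section \<open>Semidefiniteness of the diffusion matrix\<close>

lemma diffusion_component:
  "diffusion T \<alpha> x t $ i $ j = (\<alpha> x (T - t) $ i \<bullet> \<alpha> x (T - t) $ j) / 2"
  by (simp add: diffusion_def matrix_matrix_mult_def transpose_def inner_vec_def)

text \<open>The diffusion matrix is half the sum of the outer products of the columns of
  \<open>\<alpha>\<close> with themselves, so the trace is half the sum of the values of the
  quadratic form \<open>H\<close> on these columns.\<close>

lemma diffusion_trace_nonneg:
  fixes H :: "'n::finite \<Rightarrow> 'n \<Rightarrow> real" and \<alpha> :: "real ^ 'n \<Rightarrow> real \<Rightarrow> real ^ 'n ^ 'n"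
  assumes "\<And>\<xi> :: real ^ 'n. 0 \<le> (\<Sum>i\<in>UNIV. \<Sum>j\<in>UNIV. \<xi> $ i * \<xi> $ j * H i j)"
  shows "0 \<le> (\<Sum>i\<in>UNIV. \<Sum>j\<in>UNIV. diffusion T \<alpha> x t $ i $ j * H i j)"
proof -
  let ?A = "\<alpha> x (T - t)"
  have "(\<Sum>i\<in>UNIV. \<Sum>j\<in>UNIV. diffusion T \<alpha> x t $ i $ j * H i j)
      = (\<Sum>i\<in>UNIV. \<Sum>j\<in>UNIV. \<Sum>l\<in>UNIV. ?A $ i $ l * ?A $ j $ l * H i j / 2)"
    by (simp add: diffusion_component inner_vec_def sum_divide_distrib sum_distrib_right)
  also have "\<dots> = (\<Sum>i\<in>UNIV. \<Sum>l\<in>UNIV. \<Sum>j\<in>UNIV. ?A $ i $ l * ?A $ j $ l * H i j / 2)"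
    by (intro sum.cong refl sum.swap)
  also have "\<dots> = (\<Sum>l\<in>UNIV. \<Sum>i\<in>UNIV. \<Sum>j\<in>UNIV. ?A $ i $ l * ?A $ j $ l * H i j / 2)"
    by (rule sum.swap)
  also have "\<dots> = (\<Sum>l\<in>UNIV. (\<Sum>i\<in>UNIV. \<Sum>j\<in>UNIV. ?A $ i $ l * ?A $ j $ l * H i j) / 2)"
    by (simp add: sum_divide_distrib)
  also have "\<dots> \<ge> 0"
  proof (intro sum_nonneg)
    show "0 \<le> (\<Sum>i\<in>UNIV. \<Sum>j\<in>UNIV. ?A $ i $ l * ?A $ j $ l * H i j) / 2" for l
      using assms[of "column l ?A"] by (simp add: column_def)
  qed
  finally show ?thesis .
qed

text \<open>The minimum in time is compared with earlier times only, so that the final time is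
  admissible; this gives \<open>Dt \<le> 0\<close>, the favourable sign. The coefficients may be
  taken at any \<open>x\<close> and \<open>t\<close>, since only their semidefiniteness
  enters.\<close>

lemma parabolic_operator_nonneg_at_min:
  fixes v :: "real ^ 'n \<Rightarrow> real \<Rightarrow> real"
  assumes "open V" "z \<in> V" "r < s"
    and der: "\<And>x i. x \<in> V \<Longrightarrow> ((\<lambda>h. v (x + h *\<^sub>R axis i 1) s) has_real_derivative D i x) (at 0)"
    and cont: "\<And>i. continuous_on V (D i)"
    and der2: "\<And>x i j. x \<in> V \<Longrightarrow>
      ((\<lambda>h. D i (x + h *\<^sub>R axis j 1)) has_real_derivative D2 i j x) (at 0)"
    and cont2: "\<And>i j. continuous_on V (D2 i j)"
    and dert: "(v z has_real_derivative Dt) (at s)"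
    and min: "\<And>x. x \<in> V \<Longrightarrow> v z s \<le> v x s"
    and mint: "\<And>t. r < t \<Longrightarrow> t < s \<Longrightarrow> v z s \<le> v z t"
  shows "0 \<le> (\<Sum>i\<in>UNIV. \<Sum>j\<in>UNIV. diffusion T \<alpha> x t $ i $ j * D2 i j z) - Dt"
proof -
  have "0 \<le> (\<Sum>i\<in>UNIV. \<Sum>j\<in>UNIV. diffusion T \<alpha> x t $ i $ j * D2 i j z)"
    by (intro diffusion_trace_nonneg
        second_derivative_nonneg_at_min[where f = "\<lambda>x. v x s", OF assms(1,2) der cont der2 cont2 min])
  moreover have "Dt \<le> 0"
  proof (rule ccontr)
    assume "\<not> Dt \<le> 0"
    then obtain d where "d > 0" and d: "\<And>h. 0 < h \<Longrightarrow> h < d \<Longrightarrow> v z (s - h) < v z s"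
      using DERIV_pos_inc_left[OF dert] by auto
    define h where "h = min d (s - r) / 2"
    have "0 < h" "h < d" "r < s - h"
      using \<open>d > 0\<close> \<open>r < s\<close> by (auto simp: h_def min_def field_simps)
    then show False
      using d[of h] mint[of "s - h"] by auto
  qed
  ultimately show ?thesis
    by simp
qed

section \<open>The excess over the boundary values\<close>

definition face_proj :: "'n \<Rightarrow> real ^ 'n \<Rightarrow> real ^ 'n" where
  "face_proj k x = (\<chi> i. if i = k then 0 else x $ i)"

lemma face_proj_component [simp]: "face_proj k x $ i = (if i = k then 0 else x $ i)"
  by (simp add: face_proj_def)

lemma face_proj_line:
  "face_proj k (x + s *\<^sub>R axis i 1) = face_proj k x + (if i = k then 0 else s) *\<^sub>R axis i 1"
  by (simp add: vec_eq_iff axis_def)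

lemma continuous_on_face_proj [continuous_intros]:
  "continuous_on S f \<Longrightarrow> continuous_on S (\<lambda>x. face_proj k (f x))"
  unfolding face_proj_def
proof (rule continuous_on_vec_lambda)
  show "continuous_on S (\<lambda>x. if i = k then 0 else f x $ i)" if "continuous_on S f" for i
    using that by (cases "i = k") (auto intro: continuous_intros)
qed

lemma face_proj_open_face: "x \<in> open_face UNIV \<Longrightarrow> face_proj k x \<in> open_face (- {k})"
  by (simp add: open_face_def)

lemma open_face_subset_orthant: "open_face S \<subseteq> orthant"
  unfolding open_face_def orthant_def by (force intro: less_imp_le)

lemma open_open_face_UNIV: "open (open_face UNIV :: (real ^ 'n) set)"
proof -
  have "open_face UNIV = (\<Inter>i. {x :: real ^ 'n. 0 < x $ i})"
    by (auto simp: open_face_def)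
  moreover have "open {x :: real ^ 'n. 0 < x $ i}" for i
    by (intro open_Collect_less continuous_intros)
  ultimately show ?thesis
    by auto
qed

lemma C21_continuous_on_slice:
  assumes "continuous_on (S \<times> {0<..}) (\<lambda>(x, t). f x t)" "(t :: real) > 0"
  shows "continuous_on S (\<lambda>x. f x t)"
proof -
  have "continuous_on S (\<lambda>x. (\<lambda>(x, t). f x t) (x, t))"
    using assms(2) by (intro continuous_on_compose2[OF assms(1)] continuous_intros) auto
  then show ?thesis
    by simp
qed

lemma C21_on_faceD:
  assumes "C21_on_face S u ux uxx ut" "t > 0"
  shows "x \<in> open_face S \<Longrightarrow> i \<in> S \<Longrightarrow>
      ((\<lambda>s. u (x + s *\<^sub>R axis i 1) t) has_real_derivative ux i x t) (at 0)"
    and "x \<in> open_face S \<Longrightarrow> i \<in> S \<Longrightarrow> j \<in> S \<Longrightarrow>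
      ((\<lambda>s. ux i (x + s *\<^sub>R axis j 1) t) has_real_derivative uxx i j x t) (at 0)"
    and "x \<in> open_face S \<Longrightarrow> (u x has_real_derivative ut x t) (at t)"
    and "i \<in> S \<Longrightarrow> continuous_on (open_face S) (\<lambda>x. ux i x t)"
    and "i \<in> S \<Longrightarrow> j \<in> S \<Longrightarrow> continuous_on (open_face S) (\<lambda>x. uxx i j x t)"
proof -
  note C = assms(1)[unfolded C21_on_face_def]
  show "x \<in> open_face S \<Longrightarrow> i \<in> S \<Longrightarrow>
      ((\<lambda>s. u (x + s *\<^sub>R axis i 1) t) has_real_derivative ux i x t) (at 0)"
    "x \<in> open_face S \<Longrightarrow> i \<in> S \<Longrightarrow> j \<in> S \<Longrightarrow>
      ((\<lambda>s. ux i (x + s *\<^sub>R axis j 1) t) has_real_derivative uxx i j x t) (at 0)"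
    "x \<in> open_face S \<Longrightarrow> (u x has_real_derivative ut x t) (at t)"
    using C assms(2) by blast+
  show "i \<in> S \<Longrightarrow> continuous_on (open_face S) (\<lambda>x. ux i x t)"
    by (rule C21_continuous_on_slice[OF _ assms(2)]) (use C in blast)
  show "i \<in> S \<Longrightarrow> j \<in> S \<Longrightarrow> continuous_on (open_face S) (\<lambda>x. uxx i j x t)"
    by (rule C21_continuous_on_slice[OF _ assms(2)]) (use C in blast)
qed

lemma black_scholes_solution_on_face:
  assumes "black_scholes_solution T \<alpha> g u"
  obtains ux uxx ut where "C21_on_face S u ux uxx ut"
    "\<And>x t. x \<in> open_face S \<Longrightarrow> t > 0 \<Longrightarrow>
      (\<Sum>i\<in>S. \<Sum>j\<in>S. diffusion T \<alpha> x t $ i $ j * uxx i j x t) - ut x t = 0"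
proof -
  have "\<exists>ux uxx ut. C21_on_face S u ux uxx ut \<and>
      (\<forall>x\<in>open_face S. \<forall>t>0.
        (\<Sum>i\<in>S. \<Sum>j\<in>S. diffusion T \<alpha> x t $ i $ j * uxx i j x t) - ut x t = 0)"
    using assms unfolding black_scholes_solution_def by (elim conjE allE)
  then show thesis
    by (elim exE conjE) (rule that, assumption, simp)
qed

text \<open>As \<open>a\<^sub>i\<^sub>j\<close> depends on \<open>x\<^sub>i\<close> and \<open>x\<^sub>j\<close> only, the boundary values, extended constantly in the
  direction \<open>k\<close>, solve the equation of the full orthant.\<close>

lemma excess_over_face_solves:
  fixes u :: "real ^ 'n \<Rightarrow> real \<Rightarrow> real"
  assumes H: "hypothesis_H T \<alpha>" and u: "black_scholes_solution T \<alpha> g u"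
  obtains D D2 Dt where
    "\<And>x t i. x \<in> open_face UNIV \<Longrightarrow> t > 0 \<Longrightarrow>
      ((\<lambda>s. u (x + s *\<^sub>R axis i 1) t - u (face_proj k (x + s *\<^sub>R axis i 1)) t)
        has_real_derivative D i x t) (at 0)"
    "\<And>x t i j. x \<in> open_face UNIV \<Longrightarrow> t > 0 \<Longrightarrow>
      ((\<lambda>s. D i (x + s *\<^sub>R axis j 1) t) has_real_derivative D2 i j x t) (at 0)"
    "\<And>x t. x \<in> open_face UNIV \<Longrightarrow> t > 0 \<Longrightarrow>
      ((\<lambda>s. u x s - u (face_proj k x) s) has_real_derivative Dt x t) (at t)"
    "\<And>i t. t > 0 \<Longrightarrow> continuous_on (open_face UNIV) (\<lambda>x. D i x t)"
    "\<And>i j t. t > 0 \<Longrightarrow> continuous_on (open_face UNIV) (\<lambda>x. D2 i j x t)"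
    "\<And>x t. x \<in> open_face UNIV \<Longrightarrow> t > 0 \<Longrightarrow>
      (\<Sum>i\<in>UNIV. \<Sum>j\<in>UNIV. diffusion T \<alpha> x t $ i $ j * D2 i j x t) - Dt x t = 0"
proof -
  let ?p = "face_proj k" and ?F = "open_face UNIV :: (real ^ 'n) set"
  obtain ux uxx ut where C: "C21_on_face UNIV u ux uxx ut"
    and eq: "\<And>x t. x \<in> ?F \<Longrightarrow> t > 0 \<Longrightarrow>
      (\<Sum>i\<in>UNIV. \<Sum>j\<in>UNIV. diffusion T \<alpha> x t $ i $ j * uxx i j x t) - ut x t = 0"
    by (fact black_scholes_solution_on_face[OF u])
  obtain ux' uxx' ut' where C': "C21_on_face (- {k}) u ux' uxx' ut'"
    and eq': "\<And>x t. x \<in> open_face (- {k}) \<Longrightarrow> t > 0 \<Longrightarrow>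
      (\<Sum>i\<in>-{k}. \<Sum>j\<in>-{k}. diffusion T \<alpha> x t $ i $ j * uxx' i j x t) - ut' x t = 0"
    by (fact black_scholes_solution_on_face[OF u])
  have slice: "continuous_on ?F (\<lambda>x. f (?p x) t)"
    if "continuous_on (open_face (- {k})) (\<lambda>x. f x t)"
    for f :: "real ^ 'n \<Rightarrow> real \<Rightarrow> real" and t
    by (rule continuous_on_compose2[OF that])
      (auto intro!: continuous_intros face_proj_open_face)
  \<comment> \<open>The projected point does not move in direction \<open>k\<close>, so the boundary
    values contribute no derivative there; \<open>ux'\<close> and \<open>uxx'\<close> carry
    information for the other indices only.\<close>
  define D where "D i x t = ux i x t - (if i = k then 0 else ux' i (?p x) t)" for i x t
  define D2 where "D2 i j x t = uxx i j x t - (if i = k \<or> j = k then 0 else uxx' i j (?p x) t)"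
    for i j x t
  define Dt where "Dt x t = ut x t - ut' (?p x) t" for x t
  show thesis
  proof
    fix x :: "real ^ 'n" and t :: real
    assume x: "x \<in> ?F" and t: "t > 0"
    note px = face_proj_open_face[OF x, of k]
    note d = C21_on_faceD[OF C t] and d' = C21_on_faceD[OF C' t]
    show "((\<lambda>s. u (x + s *\<^sub>R axis i 1) t - u (?p (x + s *\<^sub>R axis i 1)) t)
        has_real_derivative D i x t) (at 0)" for i
    proof (cases "i = k")
      case True
      then show ?thesis
        using DERIV_diff[OF d(1)[OF x UNIV_I] DERIV_const] by (simp add: D_def face_proj_line)
    next
      case False
      then show ?thesis
        using DERIV_diff[OF d(1)[OF x UNIV_I] d'(1)[OF px]] by (simp add: D_def face_proj_line)
    qed
    show "((\<lambda>s. D i (x + s *\<^sub>R axis j 1) t) has_real_derivative D2 i j x t) (at 0)" for i j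
    proof (cases "i = k \<or> j = k")
      case True
      then have "(\<lambda>s. D i (x + s *\<^sub>R axis j 1) t) =
          (\<lambda>s. ux i (x + s *\<^sub>R axis j 1) t - (if i = k then 0 else ux' i (?p x) t))"
        by (auto simp: D_def face_proj_line)
      then show ?thesis
        using DERIV_diff[OF d(2)[OF x UNIV_I UNIV_I, of i j] DERIV_const] True
        by (simp add: D2_def)
    next
      case False
      then show ?thesis
        using DERIV_diff[OF d(2)[OF x UNIV_I UNIV_I] d'(2)[OF px]]
        by (simp add: D_def D2_def face_proj_line)
    qed
    show "((\<lambda>s. u x s - u (?p x) s) has_real_derivative Dt x t) (at t)"
      unfolding Dt_def by (intro DERIV_diff d(3)[OF x] d'(3)[OF px])
    \<comment> \<open>Row \<open>i\<close> of \<open>\<alpha>\<close> depends on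
      \<open>x $ i\<close> and time alone, and the projection alters coordinate \<open>k\<close>
      only. Hence the equation on the face holds with the coefficients taken at \<open>x\<close>
      itself.\<close>
    have "diffusion T \<alpha> (?p x) t $ i $ j = diffusion T \<alpha> x t $ i $ j" if "i \<noteq> k" "j \<noteq> k" for i j
    proof -
      have orth: "x \<in> orthant" "?p x \<in> orthant"
        using x px open_face_subset_orthant by blast+
      have dep: "\<forall>i j. \<forall>x\<in>orthant. \<forall>y\<in>orthant. \<forall>t\<le>T.
          x $ i = y $ i \<longrightarrow> \<alpha> x t $ i $ j = \<alpha> y t $ i $ j"
        using H unfolding hypothesis_H_def by blast
      have "\<alpha> (?p x) (T - t) $ i $ j = \<alpha> x (T - t) $ i $ j" if "i \<noteq> k" for i j
        by (rule dep[rule_format, OF orth(2) orth(1)]) (use t that in auto)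
      then have "\<alpha> (?p x) (T - t) $ i = \<alpha> x (T - t) $ i" if "i \<noteq> k" for i
        using that unfolding vec_eq_iff by blast
      then show ?thesis
        using that by (simp add: diffusion_component)
    qed
    moreover have "(\<Sum>i\<in>UNIV. \<Sum>j\<in>UNIV. diffusion T \<alpha> x t $ i $ j * D2 i j x t)
        = (\<Sum>i\<in>UNIV. \<Sum>j\<in>UNIV. diffusion T \<alpha> x t $ i $ j * uxx i j x t)
          - (\<Sum>i\<in>UNIV. \<Sum>j\<in>UNIV. if i = k \<or> j = k then 0
              else diffusion T \<alpha> x t $ i $ j * uxx' i j (?p x) t)"
      unfolding D2_def sum_subtractf[symmetric] by (intro sum.cong refl) (simp add: algebra_simps)
    moreover have "(\<Sum>i\<in>UNIV. \<Sum>j\<in>UNIV. if i = k \<or> j = k then 0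
          else diffusion T \<alpha> x t $ i $ j * uxx' i j (?p x) t)
        = (\<Sum>i\<in>-{k}. \<Sum>j\<in>-{k}. diffusion T \<alpha> x t $ i $ j * uxx' i j (?p x) t)"
      by (intro sum.mono_neutral_cong_right ballI) (auto intro!: sum.mono_neutral_cong_right sum.neutral)
    ultimately show "(\<Sum>i\<in>UNIV. \<Sum>j\<in>UNIV. diffusion T \<alpha> x t $ i $ j * D2 i j x t) - Dt x t = 0"
      using eq[OF x t] eq'[OF px t] by (simp add: Dt_def)
  next
    fix t :: real
    assume t: "t > 0"
    note c = C21_on_faceD(4,5)[OF C t] and c' = C21_on_faceD(4,5)[OF C' t]
    show "continuous_on ?F (\<lambda>x. D i x t)" for i
    proof (cases "i = k")
      case True
      then show ?thesis
        using c(1) by (simp add: D_def)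
    next
      case False
      then show ?thesis
        using continuous_on_diff[OF c(1) slice[of "ux' i" t, OF c'(1)]] by (simp add: D_def)
    qed
    show "continuous_on ?F (\<lambda>x. D2 i j x t)" for i j
    proof (cases "i = k \<or> j = k")
      case True
      then show ?thesis
        using c(2) by (simp add: D2_def)
    next
      case False
      then show ?thesis
        using continuous_on_diff[OF c(2) slice[of "uxx' i j" t, OF c'(2)]] by (simp add: D2_def)
    qed
  qed
qed

section \<open>The barrier\<close>

definition dist2_along_face :: "'n \<Rightarrow> real ^ 'n \<Rightarrow> real ^ 'n \<Rightarrow> real" where
  "dist2_along_face k y x = (\<Sum>i\<in>-{k}. (x $ i - y $ i)\<^sup>2)"

text \<open>The weights \<open>2 / r\<^sup>2\<close> and \<open>2 / r\<close> push the bracket down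
  to at most \<open>-1\<close> once the squared distance reaches \<open>r\<^sup>2\<close> or
  \<open>t0 - t\<close> reaches \<open>r\<close> (for \<open>t \<le> t0\<close>). This leaves room
  for the last term as long as that term is at most \<open>x $ k\<close>.\<close>

definition barrier ::
  "'n \<Rightarrow> real ^ 'n \<Rightarrow> real \<Rightarrow> real \<Rightarrow> real \<Rightarrow> real \<Rightarrow> real ^ 'n \<Rightarrow> real \<Rightarrow> real" where
  "barrier k y t0 r A \<kappa> x t =
    x $ k * (1 - 2 / r\<^sup>2 * dist2_along_face k y x - 2 / r * (t0 - t)) + A * (x $ k) powr (1 + \<kappa>)"

definition barrier_dx ::
  "'n \<Rightarrow> real ^ 'n \<Rightarrow> real \<Rightarrow> real \<Rightarrow> real \<Rightarrow> real \<Rightarrow> 'n \<Rightarrow> real ^ 'n \<Rightarrow> real \<Rightarrow> real" where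
  "barrier_dx k y t0 r A \<kappa> i x t =
    (if i = k
     then 1 - 2 / r\<^sup>2 * dist2_along_face k y x - 2 / r * (t0 - t) + A * (1 + \<kappa>) * (x $ k) powr \<kappa>
     else - (4 / r\<^sup>2) * x $ k * (x $ i - y $ i))"

text \<open>There is no time argument because \<open>t\<close> enters the barrier only through a
  term linear in \<open>x $ k\<close>.\<close>

definition barrier_dxx ::
  "'n \<Rightarrow> real ^ 'n \<Rightarrow> real \<Rightarrow> real \<Rightarrow> real \<Rightarrow> 'n \<Rightarrow> 'n \<Rightarrow> real ^ 'n \<Rightarrow> real" where
  "barrier_dxx k y r A \<kappa> i j x =
    (if i = k
     then if j = k then A * (1 + \<kappa>) * \<kappa> * (x $ k) powr (\<kappa> - 1) else - (4 / r\<^sup>2) * (x $ j - y $ j)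
     else if j = k then - (4 / r\<^sup>2) * (x $ i - y $ i)
     else if i = j then - (4 / r\<^sup>2) * x $ k else 0)"

section \<open>Calculus of the barrier\<close>

lemma dist2_along_face_derivative:
  "((\<lambda>s. dist2_along_face k y (x + s *\<^sub>R axis i 1)) has_real_derivative
    (if i = k then 0 else 2 * (x $ i - y $ i))) (at 0)"
proof -
  have "((\<lambda>s. ((x + s *\<^sub>R axis i 1) $ l - y $ l)\<^sup>2) has_real_derivative
      (if l = i then 2 * (x $ i - y $ i) else 0)) (at 0)" for l
    by (cases "l = i") (auto simp: axis_def intro!: derivative_eq_intros)
  then have "((\<lambda>s. dist2_along_face k y (x + s *\<^sub>R axis i 1)) has_real_derivative
      (\<Sum>l\<in>-{k}. if l = i then 2 * (x $ i - y $ i) else 0)) (at 0)"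
    unfolding dist2_along_face_def by (intro DERIV_sum)
  then show ?thesis
    by (simp add: sum.delta split: if_splits)
qed

lemma coordinate_derivative:
  "((\<lambda>s. (x + s *\<^sub>R axis i 1) $ k) has_real_derivative (if i = k then 1 else 0)) (at 0)"
  by (cases "i = k") (auto simp: axis_def intro!: derivative_eq_intros)

lemma coordinate_powr_derivative:
  assumes "x $ k > 0"
  shows "((\<lambda>s. (x + s *\<^sub>R axis i 1) $ k powr p) has_real_derivative
    (if i = k then p * (x $ k) powr (p - 1) else 0)) (at 0)"
proof -
  have "((\<lambda>z. z powr p) has_real_derivative p * (x $ k) powr (p - 1)) (at ((x + 0 *\<^sub>R axis i 1) $ k))"
    using has_real_derivative_powr[OF assms, of p] by simp
  from DERIV_chain2[OF this coordinate_derivative] show ?thesis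
    by (cases "i = k") auto
qed

lemma barrier_derivatives:
  assumes "x $ k > 0" "r \<noteq> 0"
  shows "((\<lambda>s. barrier k y t0 r A \<kappa> (x + s *\<^sub>R axis i 1) t)
      has_real_derivative barrier_dx k y t0 r A \<kappa> i x t) (at 0)"
    and "((\<lambda>s. barrier_dx k y t0 r A \<kappa> i (x + s *\<^sub>R axis j 1) t)
      has_real_derivative barrier_dxx k y r A \<kappa> i j x) (at 0)"
    and "((\<lambda>t. barrier k y t0 r A \<kappa> x t) has_real_derivative 2 / r * x $ k) (at t)"
proof -
  note [derivative_intros] = dist2_along_face_derivative coordinate_derivative
    coordinate_powr_derivative[OF assms(1)]
  show "((\<lambda>s. barrier k y t0 r A \<kappa> (x + s *\<^sub>R axis i 1) t)
      has_real_derivative barrier_dx k y t0 r A \<kappa> i x t) (at 0)"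
    unfolding barrier_def barrier_dx_def
    by (rule derivative_eq_intros refl)+ (auto simp: algebra_simps)
  show "((\<lambda>s. barrier_dx k y t0 r A \<kappa> i (x + s *\<^sub>R axis j 1) t)
      has_real_derivative barrier_dxx k y r A \<kappa> i j x) (at 0)"
  proof (cases "i = k")
    case True
    then show ?thesis
      unfolding barrier_dx_def barrier_dxx_def
      by (simp only: True refl if_True) ((rule derivative_eq_intros refl)+, auto simp: algebra_simps)
  next
    case False
    then show ?thesis
      unfolding barrier_dx_def barrier_dxx_def
      by (simp only: False if_False)
        ((rule derivative_eq_intros refl)+, use False in \<open>auto simp: algebra_simps\<close>)
  qed
  show "((\<lambda>t. barrier k y t0 r A \<kappa> x t) has_real_derivative 2 / r * x $ k) (at t)"
    unfolding barrier_def using assms(2) by (auto intro!: derivative_eq_intros)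
qed

lemma continuous_on_dist2_along_face [continuous_intros]:
  "continuous_on S f \<Longrightarrow> continuous_on S (\<lambda>x. dist2_along_face k y (f x))"
  unfolding dist2_along_face_def by (intro continuous_intros)

lemma continuous_on_barrier_derivatives:
  fixes S :: "(real ^ 'n) set"
  assumes "\<And>x. x \<in> S \<Longrightarrow> x $ k > 0" "r \<noteq> 0"
  shows "continuous_on S (\<lambda>x. barrier_dx k y t0 r A \<kappa> i x t)"
    and "continuous_on S (barrier_dxx k y r A \<kappa> i j)"
proof -
  have [continuous_intros]: "continuous_on S (\<lambda>x. (x $ k) powr p)" for p
    using assms by (intro continuous_on_powr continuous_intros) (auto dest: assms(1))
  show "continuous_on S (\<lambda>x. barrier_dx k y t0 r A \<kappa> i x t)"
    unfolding barrier_dx_def by (cases "i = k") (auto intro!: continuous_intros simp: assms(2))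
  show "continuous_on S (barrier_dxx k y r A \<kappa> i j)"
    unfolding barrier_dxx_def
    by (cases "i = k"; cases "j = k"; cases "i = j") (auto intro!: continuous_intros simp: assms(2))
qed

text \<open>In contrast to the second derivatives, where the exponent \<open>\<kappa> - 1\<close>
  may be negative, continuity reaches the face itself. The compact cylinder of the comparison
  includes part of that face.\<close>

lemma continuous_on_barrier:
  assumes "0 < \<kappa>" "r \<noteq> 0"
  shows "continuous_on ({x. 0 \<le> x $ k} \<times> UNIV) (\<lambda>(x, t). barrier k y t0 r A \<kappa> x t)"
  unfolding barrier_def case_prod_unfold using assms
  by (intro continuous_intros continuous_on_powr') auto

text \<open>With \<open>\<beta> = 2 - 2\<kappa>\<close>, the correction \<open>A x\<^sub>k\<^bsup>1+\<kappa>\<^esup>\<close> is of higher order at the face, yet its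
  contribution \<open>a\<^sub>k\<^sub>k x\<^sub>k\<^bsup>\<kappa>-1\<^esup> \<ge> const \<sqdot> \<surd>a\<^sub>k\<^sub>k\<close> dominates the mixed terms, for which only
  \<open>\<bar>a\<^sub>k\<^sub>j\<bar> \<le> const \<sqdot> \<surd>a\<^sub>k\<^sub>k\<close> is available.\<close>

lemma barrier_strict_subsolution:
  fixes \<alpha> :: "real ^ 'n \<Rightarrow> real \<Rightarrow> real ^ 'n ^ 'n" and N r A \<kappa> C :: real
  assumes "0 < \<kappa>" "0 < C" "0 < r"
    and x: "0 < x $ k" "x $ k \<le> 1" "dist2_along_face k y x \<le> r\<^sup>2"
    and N: "norm (\<alpha> x (T - t)) \<le> N"
    and lower: "C * (x $ k) powr (2 - 2 * \<kappa>) \<le> diffusion T \<alpha> x t $ k $ k"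
    and A1: "16 * CARD('n) * N / r \<le> A * \<kappa> * sqrt (2 * C)"
    and A2: "2 * (2 * CARD('n) * N\<^sup>2 / r\<^sup>2 + 2 / r) < A * \<kappa> * C"
  shows "0 < (\<Sum>i\<in>UNIV. \<Sum>j\<in>UNIV. diffusion T \<alpha> x t $ i $ j * barrier_dxx k y r A \<kappa> i j x)
      - 2 / r * x $ k"
proof -
  let ?a = "\<lambda>i j. diffusion T \<alpha> x t $ i $ j" and ?h = "\<lambda>i j. barrier_dxx k y r A \<kappa> i j x"
  \<comment> \<open>\<open>R\<close> equals the square root of \<open>2 * ?a k k\<close>. Keeping it
    in the mixed terms, instead of estimating it by \<open>N\<close>, is what lets them be absorbed
    where \<open>?a k k\<close> degenerates.\<close>
  define R where "R = norm (\<alpha> x (T - t) $ k)"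
  define X where "X = x $ k"
  have "0 \<le> N"
    using N norm_ge_zero order_trans by blast
  have "0 \<le> R"
    by (simp add: R_def)
  have row: "norm (\<alpha> x (T - t) $ i) \<le> N" for i
    by (rule order_trans[OF Finite_Cartesian_Product.norm_nth_le N])
  have akk: "?a k k = R\<^sup>2 / 2"
    by (simp add: diffusion_component R_def power2_norm_eq_inner)
  have akj: "\<bar>?a k j\<bar> \<le> R * N / 2" "\<bar>?a j k\<bar> \<le> R * N / 2" for j
  proof -
    have "\<bar>\<alpha> x (T - t) $ k \<bullet> \<alpha> x (T - t) $ j\<bar> \<le> R * N"
      unfolding R_def using Cauchy_Schwarz_ineq2 row
      by (meson mult_left_mono norm_ge_zero order_trans)
    then show "\<bar>?a k j\<bar> \<le> R * N / 2" "\<bar>?a j k\<bar> \<le> R * N / 2"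
      by (simp_all add: diffusion_component inner_commute)
  qed
  have ajj: "?a j j \<le> N\<^sup>2 / 2" for j
    using power_mono[OF row[of j] norm_ge_zero, of 2]
    by (simp add: diffusion_component power2_norm_eq_inner)
  have dist: "\<bar>x $ j - y $ j\<bar> \<le> r" if "j \<noteq> k" for j
  proof -
    have "(x $ j - y $ j)\<^sup>2 \<le> dist2_along_face k y x"
      unfolding dist2_along_face_def using that by (intro member_le_sum) auto
    then have "\<bar>x $ j - y $ j\<bar>\<^sup>2 \<le> r\<^sup>2"
      using x(3) by simp
    then show ?thesis
      using power2_le_imp_le \<open>0 < r\<close> less_imp_le by blast
  qed
  have mixed: "a * (- (4 / r\<^sup>2) * (x $ j - y $ j)) \<ge> - (2 * R * N / r)"
    if "j \<noteq> k" "\<bar>a\<bar> \<le> R * N / 2" for j a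
  proof -
    have "\<bar>a * (- (4 / r\<^sup>2) * (x $ j - y $ j))\<bar> = \<bar>a\<bar> * (4 / r\<^sup>2 * \<bar>x $ j - y $ j\<bar>)"
      by (simp only: abs_mult abs_minus_cancel abs_divide) simp
    also have "\<dots> \<le> (R * N / 2) * (4 / r\<^sup>2 * r)"
      using that dist \<open>0 \<le> R\<close> \<open>0 \<le> N\<close> by (intro mult_mono mult_left_mono) auto
    also have "\<dots> = 2 * R * N / r"
      using \<open>0 < r\<close> by (simp add: field_simps power2_eq_square)
    finally show ?thesis
      by linarith
  qed
  have diag: "?a j j * (- (4 / r\<^sup>2) * X) \<ge> - (2 * N\<^sup>2 / r\<^sup>2 * X)" for j
  proof -
    have "?a j j * (4 / r\<^sup>2 * X) \<le> N\<^sup>2 / 2 * (4 / r\<^sup>2 * X)"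
      using ajj x(1) by (intro mult_right_mono) (auto simp: X_def)
    then show ?thesis
      by (simp add: mult_ac)
  qed
  have "card (- {k}) \<le> CARD('n)"
    by (intro card_mono) auto
  then have card: "card (- {k}) * b \<le> CARD('n) * b" if "0 \<le> b" for b :: real
    using that by (intro mult_right_mono) auto
  have "(\<Sum>i\<in>UNIV. \<Sum>j\<in>UNIV. ?a i j * ?h i j)
      = (\<Sum>j\<in>UNIV. ?a k j * ?h k j) + (\<Sum>i\<in>-{k}. \<Sum>j\<in>UNIV. ?a i j * ?h i j)"
    by (subst sum.remove[of UNIV k]) (auto simp: Compl_eq_Diff_UNIV)
  also have "(\<Sum>j\<in>UNIV. ?a k j * ?h k j) = ?a k k * ?h k k + (\<Sum>j\<in>-{k}. ?a k j * ?h k j)"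
    by (subst sum.remove[of UNIV k]) (auto simp: Compl_eq_Diff_UNIV)
  also have "(\<Sum>i\<in>-{k}. \<Sum>j\<in>UNIV. ?a i j * ?h i j)
      = (\<Sum>i\<in>-{k}. ?a i k * ?h i k + ?a i i * ?h i i)"
  proof (intro sum.cong refl)
    fix i
    assume "i \<in> - {k}"
    \<comment> \<open>In a row other than \<open>k\<close> the Hessian of the barrier has entries
      only in column \<open>k\<close> and on the diagonal.\<close>
    then have "(\<Sum>j\<in>UNIV. ?a i j * ?h i j) = (\<Sum>j\<in>{k, i}. ?a i j * ?h i j)"
      by (intro sum.mono_neutral_right) (auto simp: barrier_dxx_def)
    then show "(\<Sum>j\<in>UNIV. ?a i j * ?h i j) = ?a i k * ?h i k + ?a i i * ?h i i"
      using \<open>i \<in> - {k}\<close> by simp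
  qed
  finally have split: "(\<Sum>i\<in>UNIV. \<Sum>j\<in>UNIV. ?a i j * ?h i j) =
      ?a k k * ?h k k + (\<Sum>j\<in>-{k}. ?a k j * ?h k j + (?a j k * ?h j k + ?a j j * ?h j j))"
    by (simp add: sum.distrib)
  have "(\<Sum>j\<in>-{k}. ?a k j * ?h k j + (?a j k * ?h j k + ?a j j * ?h j j))
      \<ge> (\<Sum>j\<in>-{k}. - (4 * R * N / r + 2 * N\<^sup>2 / r\<^sup>2 * X))"
  proof (rule sum_mono)
    fix j
    assume "j \<in> - {k}"
    then show "- (4 * R * N / r + 2 * N\<^sup>2 / r\<^sup>2 * X)
        \<le> ?a k j * ?h k j + (?a j k * ?h j k + ?a j j * ?h j j)"
      using mixed[OF _ akj(1), of j j] mixed[OF _ akj(2), of j j] diag[of j]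
      by (simp add: barrier_dxx_def X_def)
  qed
  moreover have "(\<Sum>j\<in>-{k}. - (4 * R * N / r + 2 * N\<^sup>2 / r\<^sup>2 * X))
      \<ge> - (CARD('n) * (4 * R * N / r + 2 * N\<^sup>2 / r\<^sup>2 * X))"
    unfolding sum_constant mult_minus_right neg_le_iff_le
    using \<open>0 \<le> R\<close> \<open>0 \<le> N\<close> \<open>0 < r\<close> x(1) by (intro card) (simp add: X_def)
  moreover have "?a k k * ?h k k > CARD('n) * (4 * R * N / r + 2 * N\<^sup>2 / r\<^sup>2 * X) + 2 / r * X"
  proof -
    \<comment> \<open>By \<open>akk\<close> this is \<open>?a k k * X powr (\<kappa> - 1)\<close>,
      the positive term that has to dominate. It is bounded below by a multiple of \<open>R\<close>
      (\<open>pR\<close>), to match the mixed terms, and of \<open>X\<close> (\<open>pX\<close>), to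
      match the remaining ones.\<close>
    define p where "p = R\<^sup>2 / 2 * X powr (\<kappa> - 1)"
    have "X > 0" "X \<le> 1"
      using x by (auto simp: X_def)
    have lower': "C * X powr (2 - 2 * \<kappa>) \<le> R\<^sup>2 / 2"
      using lower by (simp add: akk X_def)
    have "0 < A * \<kappa> * C"
      using A2 \<open>0 < r\<close> \<open>0 \<le> N\<close> by (smt (verit) divide_nonneg_nonneg mult_nonneg_nonneg of_nat_0_le_iff zero_le_power2 divide_pos_pos)
    then have "0 < A"
      using \<open>0 < \<kappa>\<close> \<open>0 < C\<close> by (simp add: zero_less_mult_iff)
    have pR: "R * sqrt (2 * C) / 2 \<le> p"
    proof -
      \<comment> \<open>The square root of the lower bound on \<open>?a k k\<close> gives
        \<open>R \<ge> sqrt (2 * C) * X powr (1 - \<kappa>)\<close>; one of the two factors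
        \<open>R\<close> in \<open>p\<close> then cancels the power of \<open>X\<close>.\<close>
      have "(sqrt (2 * C) * X powr (1 - \<kappa>))\<^sup>2 = 2 * (C * X powr (2 - 2 * \<kappa>))"
        using \<open>0 < C\<close> \<open>0 < X\<close> by (simp add: power_mult_distrib powr_power algebra_simps)
      also have "\<dots> \<le> R\<^sup>2"
        using lower' by simp
      finally have "sqrt (2 * C) * X powr (1 - \<kappa>) \<le> R"
        using \<open>0 \<le> R\<close> power2_le_imp_le by blast
      then have "(sqrt (2 * C) * X powr (1 - \<kappa>)) * (R * X powr (\<kappa> - 1)) \<le> R * (R * X powr (\<kappa> - 1))"
        using \<open>0 \<le> R\<close> by (intro mult_right_mono) auto
      also have "R * (R * X powr (\<kappa> - 1)) = 2 * p"
        by (simp add: p_def power2_eq_square)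
      also have "(sqrt (2 * C) * X powr (1 - \<kappa>)) * (R * X powr (\<kappa> - 1))
          = R * sqrt (2 * C) * (X powr (1 - \<kappa>) * X powr (\<kappa> - 1))"
        by (simp only: mult_ac)
      also have "X powr (1 - \<kappa>) * X powr (\<kappa> - 1) = 1"
        using \<open>0 < X\<close> by (simp add: powr_add[symmetric])
      finally show ?thesis
        by simp
    qed
    have pX: "C * X \<le> p"
    proof -
      have "C * X powr (2 - 2 * \<kappa>) * X powr (\<kappa> - 1) \<le> p"
        unfolding p_def using lower' by (intro mult_right_mono) auto
      moreover have "X powr (2 - 2 * \<kappa>) * X powr (\<kappa> - 1) = X powr (1 - \<kappa>)"
        using \<open>0 < X\<close> by (simp add: powr_add[symmetric])
      moreover have "X powr 1 \<le> X powr (1 - \<kappa>)"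
        using \<open>0 < X\<close> \<open>X \<le> 1\<close> \<open>0 < \<kappa>\<close> by (intro powr_mono') auto
      ultimately show ?thesis
        using \<open>0 < X\<close> \<open>0 < C\<close> by (smt (verit) mult.assoc mult_left_mono powr_one)
    qed
    \<comment> \<open>The mixed terms cost \<open>4 * P\<close>, the diagonal and time terms cost
      \<open>Y\<close>. The constants \<open>16\<close> in \<open>A1\<close> and \<open>2\<close> in
      \<open>A2\<close> make each cost at most half of \<open>A * \<kappa> * p\<close>, the second
      one strictly less.\<close>
    define P where "P = CARD('n) * N / r * R"
    define Y where "Y = (2 * CARD('n) * N\<^sup>2 / r\<^sup>2 + 2 / r) * X"
    have "16 * P \<le> A * \<kappa> * sqrt (2 * C) * R"
      using mult_right_mono[OF A1 \<open>0 \<le> R\<close>] by (simp add: P_def)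
    also have "\<dots> = 2 * (A * \<kappa> * (R * sqrt (2 * C) / 2))"
      by simp
    also have "A * \<kappa> * (R * sqrt (2 * C) / 2) \<le> A * \<kappa> * p"
      using pR \<open>0 < A\<close> \<open>0 < \<kappa>\<close> by (intro mult_left_mono) auto
    finally have "8 * P \<le> A * \<kappa> * p"
      by simp
    moreover have "2 * Y < A * \<kappa> * p"
    proof -
      have "2 * Y < A * \<kappa> * C * X"
        using mult_strict_right_mono[OF A2 \<open>0 < X\<close>] by (simp only: Y_def mult.assoc)
      also have "\<dots> = A * \<kappa> * (C * X)"
        by simp
      also have "\<dots> \<le> A * \<kappa> * p"
        using pX \<open>0 < A\<close> \<open>0 < \<kappa>\<close> by (intro mult_left_mono) auto
      finally show ?thesis .
    qed
    moreover have "A * \<kappa> * p \<le> ?a k k * ?h k k"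
    proof -
      have "?a k k * ?h k k = (1 + \<kappa>) * (A * \<kappa> * p)"
        by (simp add: akk barrier_dxx_def p_def X_def)
      moreover have "0 \<le> A * \<kappa> * p"
        using \<open>0 < A\<close> \<open>0 < \<kappa>\<close> by (simp add: p_def)
      ultimately show ?thesis
        using \<open>0 < \<kappa>\<close> by (simp add: distrib_right)
    qed
    moreover have "CARD('n) * (4 * R * N / r + 2 * N\<^sup>2 / r\<^sup>2 * X) + 2 / r * X = 4 * P + Y"
      by (simp add: P_def Y_def algebra_simps)
    ultimately show ?thesis
      by linarith
  qed
  ultimately show ?thesis
    using split by (simp add: X_def)
qed

section \<open>Bounds and constants for the comparison\<close>

lemma norm_diff_squared_along_face:
  "y $ k = 0 \<Longrightarrow> (norm (x - y))\<^sup>2 = (x $ k)\<^sup>2 + dist2_along_face k y x"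
  unfolding power2_norm_eq_inner inner_vec_def dist2_along_face_def
  by (subst sum.remove[of UNIV k]) (auto simp: Compl_eq_Diff_UNIV power2_eq_square)

text \<open>The correction is at most \<open>x $ k\<close>, which raises the constant in the bracket
  from \<open>1\<close> to \<open>2\<close>. So a positive barrier confines the point to the part of
  the cylinder away from its lateral and initial boundary.\<close>

lemma barrier_upper_bound:
  assumes "0 \<le> x $ k" "A * (x $ k) powr \<kappa> \<le> 1"
  shows "barrier k y t0 r A \<kappa> x t
    \<le> x $ k * (2 - 2 / r\<^sup>2 * dist2_along_face k y x - 2 / r * (t0 - t))"
proof -
  have "A * (x $ k) powr (1 + \<kappa>) = x $ k * (A * (x $ k) powr \<kappa>)"
    using assms(1) by (simp add: powr_add)
  also have "\<dots> \<le> x $ k"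
    using mult_left_mono[OF assms(2,1)] by simp
  finally show ?thesis
    by (simp add: barrier_def algebra_simps)
qed

lemma continuous_on_excess_over_face:
  assumes "black_scholes_solution T \<alpha> g u"
  shows "continuous_on (orthant \<times> {0..}) (\<lambda>(x, t). u x t - u (face_proj k x) t)"
proof -
  have u: "continuous_on (orthant \<times> {0..}) (\<lambda>(x, t). u x t)"
    using assms by (simp add: black_scholes_solution_def)
  have "continuous_on (orthant \<times> {0..}) (\<lambda>z. (\<lambda>(x, t). u x t) (face_proj k (fst z), snd z))"
    by (rule continuous_on_compose2[OF u]) (auto intro!: continuous_intros simp: orthant_def)
  then show ?thesis
    using continuous_on_diff[OF u] by (simp add: case_prod_unfold)
qed

text \<open>The order of choice matters: \<open>A\<close> depends on \<open>r\<close>,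
  \<open>N\<close>, \<open>C\<close> and \<open>\<kappa>\<close> but not on the height
  \<open>\<delta>\<close>, which can therefore be shrunk afterwards.\<close>

lemma barrier_constants:
  fixes N r C \<kappa> :: real
  assumes "0 < \<kappa>" "0 < C" "0 < r" "0 \<le> N"
  obtains A \<delta> where "0 < A" "0 < \<delta>" "\<delta> \<le> r" "A * \<delta> powr \<kappa> \<le> 1"
    "16 * real n * N / r \<le> A * \<kappa> * sqrt (2 * C)"
    "2 * (2 * real n * N\<^sup>2 / r\<^sup>2 + 2 / r) < A * \<kappa> * C"
proof -
  define P where "P = 16 * real n * N / r"
  define Q where "Q = 2 * (2 * real n * N\<^sup>2 / r\<^sup>2 + 2 / r)"
  \<comment> \<open>Adding \<open>1\<close> makes the inequality for \<open>Q\<close> strict and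
    \<open>A\<close> positive.\<close>
  define A where "A = max (P / (\<kappa> * sqrt (2 * C))) (Q / (\<kappa> * C)) + 1"
  define \<delta> where "\<delta> = min r ((1 / A) powr (1 / \<kappa>))"
  have "0 \<le> P"
    using assms by (simp add: P_def)
  then have "0 < A"
    using assms by (auto simp: A_def intro!: add_nonneg_pos max.coboundedI1)
  have "P / (\<kappa> * sqrt (2 * C)) \<le> A" "Q / (\<kappa> * C) < A"
    by (auto simp: A_def)
  then have "P \<le> A * \<kappa> * sqrt (2 * C)" "Q < A * \<kappa> * C"
    using assms by (simp_all add: divide_le_eq divide_less_eq mult.assoc)
  moreover have "0 < \<delta>" "\<delta> \<le> r"
    using \<open>0 < A\<close> \<open>0 < r\<close> by (auto simp: \<delta>_def)
  moreover have "A * \<delta> powr \<kappa> \<le> 1"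
  proof -
    have "\<delta> powr \<kappa> \<le> ((1 / A) powr (1 / \<kappa>)) powr \<kappa>"
      using \<open>0 < \<delta>\<close> assms by (intro powr_mono2) (auto simp: \<delta>_def)
    also have "\<dots> = 1 / A"
      using assms \<open>0 < A\<close> by (simp add: powr_powr)
    finally show ?thesis
      using \<open>0 < A\<close> by (simp add: field_simps)
  qed
  ultimately show thesis
    using that \<open>0 < A\<close> unfolding P_def Q_def by blast
qed

section \<open>Comparison near the boundary point\<close>

theorem theorem2p2:
  fixes T C \<beta> t0 :: real
    and \<alpha> :: "real ^ 'n \<Rightarrow> real \<Rightarrow> real ^ 'n ^ 'n"
    and g :: "real ^ 'n \<Rightarrow> real"
    and u :: "real ^ 'n \<Rightarrow> real \<Rightarrow> real"
    and k :: 'n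
    and x' :: "real ^ 'n"
    and U :: "((real ^ 'n) \<times> real) set"
  assumes "hypothesis_H T \<alpha>"
    and "continuous_on orthant g" and "poly_growth g"
    and "black_scholes_solution T \<alpha> g u"
    and "C > 0" and "0 \<le> \<beta>" and "\<beta> < 2"
    and "\<And>x t. x \<in> orthant \<Longrightarrow> x $ k > 0 \<Longrightarrow> t \<ge> 0 \<Longrightarrow>
           diffusion T \<alpha> x t $ k $ k \<ge> C * (x $ k) powr \<beta>"
    and "t0 > 0" and "x' $ k = 0" and "\<And>i. i \<noteq> k \<Longrightarrow> x' $ i > 0"
    and "open U" and "(x', t0) \<in> U"
    and "\<And>x t. (x, t) \<in> U \<Longrightarrow> x \<in> orthant \<Longrightarrow> x $ k > 0 \<Longrightarrow> 0 \<le> t \<Longrightarrow> t \<le> t0 \<Longrightarrow>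
           u x t > u (\<chi> i. if i = k then 0 else x $ i) t"
  shows "Liminf (at_right 0)
           (\<lambda>\<epsilon>. ereal (1 / \<epsilon> * (u (x' + \<epsilon> *\<^sub>R axis k 1) t0 - u x' t0))) > 0"
proof -
  note H = assms(1) and sol = assms(4) and lower = assms(8) and xk = \<open>x' $ k = 0\<close>
  define w where "w x t = u x t - u (face_proj k x) t" for x t
  define q where "q = dist2_along_face k x'"
  define \<kappa> where "\<kappa> = 1 - \<beta> / 2"
  have \<kappa>: "0 < \<kappa>" "\<beta> = 2 - 2 * \<kappa>"
    using \<open>\<beta> < 2\<close> by (auto simp: \<kappa>_def)
  have w_pos: "0 < w x t" if "(x, t) \<in> U" "x \<in> orthant" "x $ k > 0" "0 \<le> t" "t \<le> t0" for x t
    using assms(14)[OF that] by (simp add: w_def face_proj_def)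
  obtain D D2 Dt where
    D: "\<And>x t i. x \<in> open_face UNIV \<Longrightarrow> t > 0 \<Longrightarrow>
      ((\<lambda>s. w (x + s *\<^sub>R axis i 1) t) has_real_derivative D i x t) (at 0)" and
    D2: "\<And>x t i j. x \<in> open_face UNIV \<Longrightarrow> t > 0 \<Longrightarrow>
      ((\<lambda>s. D i (x + s *\<^sub>R axis j 1) t) has_real_derivative D2 i j x t) (at 0)" and
    Dt: "\<And>x t. x \<in> open_face UNIV \<Longrightarrow> t > 0 \<Longrightarrow> (w x has_real_derivative Dt x t) (at t)" and
    contD: "\<And>i t. t > 0 \<Longrightarrow> continuous_on (open_face UNIV) (\<lambda>x. D i x t)" and
    contD2: "\<And>i j t. t > 0 \<Longrightarrow> continuous_on (open_face UNIV) (\<lambda>x. D2 i j x t)" and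
    eq: "\<And>x t. x \<in> open_face UNIV \<Longrightarrow> t > 0 \<Longrightarrow>
      (\<Sum>i\<in>UNIV. \<Sum>j\<in>UNIV. diffusion T \<alpha> x t $ i $ j * D2 i j x t) - Dt x t = 0"
    unfolding w_def by (fact excess_over_face_solves[OF H sol])

  \<comment> \<open>Besides positivity of the excess, the neighborhood must guarantee positive time
    and positivity of all coordinates except \<open>k\<close>, so that only the face
    \<open>x $ k = 0\<close> is met.\<close>
  define W where "W = U \<inter> ((\<Inter>i\<in>-{k}. {x. 0 < x $ i}) \<times> {0<..})"
  have "open W"
    unfolding W_def using \<open>open U\<close>
    by (intro open_Int open_Times open_INT ballI open_Collect_less continuous_intros) auto
  moreover have "(x', t0) \<in> W"
    using assms(9,11,13) by (simp add: W_def)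
  ultimately obtain \<rho> where "0 < \<rho>" and \<rho>: "ball (x', t0) \<rho> \<subseteq> W"
    using openE by blast
  \<comment> \<open>Points of the cylinder lie within \<open>2 * r\<close> of \<open>x'\<close> in
    space and within \<open>r\<close> of \<open>t0\<close> in time, whence
    \<open>3 * r < \<rho>\<close>. The bound \<open>r \<le> 1\<close> later gives
    \<open>z $ k \<le> 1\<close> and the bound on \<open>norm z\<close>.\<close>
  define r where "r = min (\<rho> / 4) 1"
  have r: "0 < r" "r \<le> 1" "3 * r < \<rho>"
    using \<open>0 < \<rho>\<close> by (auto simp: r_def min_def)

  obtain K where K: "\<forall>x\<in>orthant. \<forall>t\<le>T. norm (\<alpha> x t) \<le> K * (1 + norm x)"
    using H unfolding hypothesis_H_def by (elim conjE exE)
  \<comment> \<open>Points of the cylinder satisfy \<open>norm z \<le> norm x' + 2\<close>; the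
    absolute value is taken because the sign of \<open>K\<close> is not given.\<close>
  define N where "N = \<bar>K\<bar> * (3 + norm x')"
  have "0 \<le> N"
    by (simp add: N_def)
  obtain A \<delta> where A: "0 < A" and \<delta>: "0 < \<delta>" "\<delta> \<le> r" "A * \<delta> powr \<kappa> \<le> 1"
    and A1: "16 * CARD('n) * N / r \<le> A * \<kappa> * sqrt (2 * C)"
    and A2: "2 * (2 * CARD('n) * N\<^sup>2 / r\<^sup>2 + 2 / r) < A * \<kappa> * C"
    using barrier_constants[OF \<kappa>(1) \<open>C > 0\<close> r(1) \<open>0 \<le> N\<close>, of "CARD('n)"] by auto
  define h where "h = barrier k x' t0 r A \<kappa>"
  have h_le: "h x t \<le> x $ k * (2 - 2 / r\<^sup>2 * q x - 2 / r * (t0 - t))"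
    if "0 \<le> x $ k" "x $ k \<le> \<delta>" for x t
  proof -
    have "A * (x $ k) powr \<kappa> \<le> A * \<delta> powr \<kappa>"
      using that A \<kappa>(1) by (intro mult_left_mono powr_mono2) auto
    then show ?thesis
      unfolding h_def q_def using that \<delta>(3) by (intro barrier_upper_bound) auto
  qed

  \<comment> \<open>The closed spatial cross-section, including its part on the face; the comparison
    takes place on \<open>Q \<times> {t0 - r..t0}\<close>.\<close>
  define Q where "Q = {x. 0 \<le> x $ k \<and> x $ k \<le> \<delta> \<and> q x \<le> r\<^sup>2}"
  have cont_q: "continuous_on S q" for S
    unfolding q_def using continuous_on_dist2_along_face[OF continuous_on_id] by (simp add: id_def)
  have q_nonneg: "0 \<le> q x" for x
    unfolding q_def dist2_along_face_def by (intro sum_nonneg) simp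
  have norm_Q: "norm (x - x') \<le> 2 * r" if "x \<in> Q" for x
  proof -
    have "(x $ k)\<^sup>2 \<le> r\<^sup>2" "q x \<le> r\<^sup>2"
      using that \<delta>(2) by (auto simp: Q_def intro: power_mono)
    then have "(norm (x - x'))\<^sup>2 \<le> r\<^sup>2 + r\<^sup>2"
      unfolding norm_diff_squared_along_face[OF xk] q_def by simp
    also have "\<dots> \<le> (2 * r)\<^sup>2"
      by (simp add: power_mult_distrib)
    finally show ?thesis
      using r(1) power2_le_imp_le[of "norm (x - x')" "2 * r"] by simp
  qed
  have Q_W: "(x, t) \<in> W" if "x \<in> Q" "t0 - r \<le> t" "t \<le> t0" for x t
  proof -
    have "dist (x', t0) (x, t) \<le> dist x' x + dist t0 t"
      unfolding dist_Pair_Pair by (rule sqrt_sum_squares_le_sum) auto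
    also have "\<dots> \<le> 3 * r"
      using norm_Q[OF that(1)] that(2,3) by (simp add: dist_norm norm_minus_commute dist_real_def)
    finally show ?thesis
      using \<rho> r(3) by (auto simp: ball_def)
  qed
  have Q_orthant: "x \<in> orthant" if "x \<in> Q" for x
  proof -
    have "0 \<le> x $ i" for i
      using Q_W[OF that, of t0] r(1) that by (cases "i = k") (auto simp: W_def Q_def less_imp_le)
    then show ?thesis
      by (simp add: orthant_def)
  qed
  have Q_face: "x \<in> open_face UNIV" if "x \<in> Q" "0 < x $ k" for x
  proof -
    have "0 < x $ i" for i
      using Q_W[OF that(1), of t0] r(1) that(2) by (cases "i = k") (auto simp: W_def)
    then show ?thesis
      by (simp add: open_face_def)
  qed
  have Q_w_pos: "0 < w x t" if "x \<in> Q" "0 < x $ k" "t0 - r \<le> t" "t \<le> t0" for x t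
    using Q_W[OF that(1,3,4)] Q_orthant[OF that(1)] that by (intro w_pos) (auto simp: W_def)
  \<comment> \<open>Applying \<open>Q_W\<close> to \<open>x'\<close> itself shows that the whole
    time interval is positive.\<close>
  have time_pos: "0 < t" if "t0 - r \<le> t" "t \<le> t0" for t
  proof -
    have "x' \<in> Q"
      using xk \<delta>(1) by (simp add: Q_def q_def dist2_along_face_def)
    then show ?thesis
      using Q_W[OF _ that] by (auto simp: W_def)
  qed

  have "closed Q"
    unfolding Q_def by (intro closed_Collect_conj closed_Collect_le continuous_intros cont_q)
  moreover have "bounded Q"
    using norm_Q by (intro bounded_subset[OF bounded_cball, of _ x' "2 * r"])
      (auto simp: dist_norm norm_minus_commute)
  ultimately have compact: "compact (Q \<times> {t0 - r..t0})"
    by (intro compact_Times compact_Icc) (simp add: compact_eq_bounded_closed)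
  have sub: "Q \<times> {t0 - r..t0} \<subseteq> orthant \<times> {0..}"
    using Q_orthant time_pos by (force intro: less_imp_le)
  have cont_w: "continuous_on (Q \<times> {t0 - r..t0}) (\<lambda>(x, t). w x t)"
    using continuous_on_subset[OF continuous_on_excess_over_face[OF sol, of k] sub] by (simp add: w_def)
  have tip: "x' + e *\<^sub>R axis k 1 \<in> Q" "(x' + e *\<^sub>R axis k 1) $ k = e" "q (x' + e *\<^sub>R axis k 1) = 0"
    if "0 \<le> e" "e \<le> \<delta>" for e
  proof -
    show *: "q (x' + e *\<^sub>R axis k 1) = 0"
      unfolding q_def dist2_along_face_def by (intro sum.neutral) (auto simp: axis_def)
    show "(x' + e *\<^sub>R axis k 1) $ k = e"
      by (simp add: xk)
    then show "x' + e *\<^sub>R axis k 1 \<in> Q"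
      using that * by (simp add: Q_def)
  qed

  \<comment> \<open>The top \<open>x $ k = \<delta>\<close> is compact and away from the face, so
    the positive excess attains a positive minimum there.\<close>
  obtain m where "0 < m" and m: "\<And>x t. x \<in> Q \<Longrightarrow> x $ k = \<delta> \<Longrightarrow> t0 - r \<le> t \<Longrightarrow> t \<le> t0 \<Longrightarrow> m \<le> w x t"
  proof -
    let ?Z = "(Q \<times> {t0 - r..t0}) \<inter> {z. fst z $ k = \<delta>}"
    have "compact ?Z"
      by (intro compact_Int_closed compact closed_Collect_eq continuous_intros)
    moreover have "(x' + \<delta> *\<^sub>R axis k 1, t0) \<in> ?Z"
      using tip[of \<delta>] \<delta>(1) r(1) by simp
    moreover have "continuous_on ?Z (\<lambda>(x, t). w x t)"
      by (rule continuous_on_subset[OF cont_w]) auto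
    ultimately obtain z where "z \<in> ?Z" and z: "\<And>y. y \<in> ?Z \<Longrightarrow> (\<lambda>(x, t). w x t) z \<le> (\<lambda>(x, t). w x t) y"
      using continuous_attains_inf[of ?Z "\<lambda>(x, t). w x t"] by blast
    show thesis
    proof (rule that)
      show "0 < w (fst z) (snd z)"
        using \<open>z \<in> ?Z\<close> \<delta>(1) by (intro Q_w_pos) auto
      show "w (fst z) (snd z) \<le> w x t" if "x \<in> Q" "x $ k = \<delta>" "t0 - r \<le> t" "t \<le> t0" for x t
        using z[of "(x, t)"] that by (simp add: case_prod_unfold)
    qed
  qed
  \<comment> \<open>On the top the barrier is at most \<open>2 * \<delta>\<close>, so there
    \<open>c * h\<close> stays below \<open>m\<close> and hence below \<open>w\<close>.\<close>
  define c where "c = m / (2 * \<delta>)"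
  have "0 < c"
    using \<open>0 < m\<close> \<delta>(1) by (simp add: c_def)
  define v where "v x t = w x t - c * h x t" for x t

  have "continuous_on (Q \<times> {t0 - r..t0}) (\<lambda>(x, t). h x t)"
    unfolding h_def
    by (rule continuous_on_subset[OF continuous_on_barrier]) (use \<kappa>(1) r(1) in \<open>auto simp: Q_def\<close>)
  then have "continuous_on (Q \<times> {t0 - r..t0}) (\<lambda>(x, t). v x t)"
    unfolding v_def using cont_w by (auto simp: case_prod_unfold intro!: continuous_intros)
  moreover have "(x', t0) \<in> Q \<times> {t0 - r..t0}"
    using tip[of 0] \<delta>(1) r(1) by simp
  ultimately obtain y where "y \<in> Q \<times> {t0 - r..t0}"
    and y: "\<forall>y'\<in>Q \<times> {t0 - r..t0}. (\<lambda>(x, t). v x t) y \<le> (\<lambda>(x, t). v x t) y'"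
    using continuous_attains_inf[OF compact, of "\<lambda>(x, t). v x t"] by blast
  then obtain z s where z: "z \<in> Q" "t0 - r \<le> s" "s \<le> t0"
    and min: "\<And>x t. x \<in> Q \<Longrightarrow> t0 - r \<le> t \<Longrightarrow> t \<le> t0 \<Longrightarrow> v z s \<le> v x t"
    by (cases y) auto
  have zk: "0 \<le> z $ k" "z $ k \<le> \<delta>" "q z \<le> r\<^sup>2"
    using z(1) by (auto simp: Q_def)
  have "0 \<le> v z s"
  \<comment> \<open>A negative minimum is excluded from each part of the parabolic boundary: on the
    face \<open>w\<close> and \<open>h\<close> vanish, on the top
    \<open>c * h \<le> m \<le> w\<close>, and on the sides and at the initial time
    \<open>h \<le> 0 < w\<close>.\<close>
  proof (rule ccontr)
    assume neg: "\<not> 0 \<le> v z s"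
    have "z $ k \<noteq> 0"
    proof
      assume "z $ k = 0"
      then have "face_proj k z = z"
        by (simp add: vec_eq_iff)
      then show False
        using neg \<open>z $ k = 0\<close> \<kappa>(1) by (simp add: v_def w_def h_def barrier_def)
    qed
    then have "0 < z $ k"
      using zk(1) by simp
    \<comment> \<open>Off the face \<open>w\<close> is positive, so a negative \<open>v\<close>
      forces a positive barrier; this keeps the point off the sides and off the initial time
      simultaneously.\<close>
    have "0 < c * h z s"
      using neg Q_w_pos[OF z(1) \<open>0 < z $ k\<close> z(2,3)] by (simp add: v_def)
    then have "0 < h z s"
      using \<open>0 < c\<close> zero_less_mult_pos by blast
    then have "0 < z $ k * (2 - 2 / r\<^sup>2 * q z - 2 / r * (t0 - s))"
      using h_le[OF zk(1,2)] less_le_trans by blast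
    then have sum_less: "2 / r\<^sup>2 * q z + 2 / r * (t0 - s) < 2"
      using \<open>0 < z $ k\<close> by (simp add: zero_less_mult_iff)
    have terms: "0 \<le> 2 / r\<^sup>2 * q z" "0 \<le> 2 / r * (t0 - s)"
      using q_nonneg r(1) z(3) by simp_all
    have "z $ k \<noteq> \<delta>"
    proof
      assume "z $ k = \<delta>"
      have "h z s \<le> \<delta> * (2 - 2 / r\<^sup>2 * q z - 2 / r * (t0 - s))"
        using h_le[OF zk(1,2)] \<open>z $ k = \<delta>\<close> by simp
      also have "\<dots> \<le> \<delta> * 2"
        using terms \<delta>(1) by (intro mult_left_mono) linarith+
      finally have "c * h z s \<le> m"
        using \<open>0 < c\<close> \<delta>(1) mult_left_mono[of "h z s" "\<delta> * 2" c] by (simp add: c_def)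
      then show False
        using m[OF z(1) \<open>z $ k = \<delta>\<close> z(2,3)] neg by (simp add: v_def)
    qed
    then have "z $ k < \<delta>"
      using zk(2) by simp
    have "2 / r\<^sup>2 * q z < 2" "2 / r * (t0 - s) < 2"
      using sum_less terms by linarith+
    then have "q z < r\<^sup>2" "t0 - r < s"
      using r(1) by (simp_all add: field_simps)
    define V where "V = {x. 0 < x $ k} \<inter> {x. x $ k < \<delta>} \<inter> {x. q x < r\<^sup>2}"
    have "open V"
      unfolding V_def by (intro open_Int open_Collect_less continuous_intros cont_q)
    have "z \<in> V"
      using \<open>0 < z $ k\<close> \<open>z $ k < \<delta>\<close> \<open>q z < r\<^sup>2\<close> by (simp add: V_def)
    have VQ: "x \<in> Q" "0 < x $ k" if "x \<in> V" for x
      using that by (auto simp: V_def Q_def)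
    have VF: "V \<subseteq> open_face UNIV"
      using VQ Q_face by blast
    have "0 < s"
      using time_pos z by blast
    let ?a = "\<lambda>i j. diffusion T \<alpha> z s $ i $ j" and ?b = "\<lambda>i j. barrier_dxx k x' r A \<kappa> i j z"
    have "r \<noteq> 0"
      using r(1) by simp
    note bd = barrier_derivatives[OF _ \<open>r \<noteq> 0\<close>]
    \<comment> \<open>Only points with \<open>s > t0 - r\<close> and \<open>z\<close> in the open
      set \<open>V\<close> remain, possibly with \<open>s = t0\<close>. There the minimum makes the
      operator applied to \<open>v\<close> nonnegative, whereas it equals \<open>- c\<close> times
      the strictly positive value for the barrier.\<close>
    have "0 \<le> (\<Sum>i\<in>UNIV. \<Sum>j\<in>UNIV. ?a i j * (D2 i j z s - c * ?b i j))
        - (Dt z s - c * (2 / r * z $ k))"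
    proof (rule parabolic_operator_nonneg_at_min[OF \<open>open V\<close> \<open>z \<in> V\<close> \<open>t0 - r < s\<close>,
          where v = v and D = "\<lambda>i x. D i x s - c * barrier_dx k x' t0 r A \<kappa> i x s"
            and ?D2.0 = "\<lambda>i j x. D2 i j x s - c * barrier_dxx k x' r A \<kappa> i j x"])
      fix x i j
      assume "x \<in> V"
      then have x: "x \<in> open_face UNIV" "0 < x $ k"
        using VF VQ by auto
      show "((\<lambda>e. v (x + e *\<^sub>R axis i 1) s) has_real_derivative
          D i x s - c * barrier_dx k x' t0 r A \<kappa> i x s) (at 0)"
        unfolding v_def h_def by (intro DERIV_diff DERIV_cmult D bd x \<open>0 < s\<close>)
      show "((\<lambda>e. D i (x + e *\<^sub>R axis j 1) s - c * barrier_dx k x' t0 r A \<kappa> i (x + e *\<^sub>R axis j 1) s)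
          has_real_derivative D2 i j x s - c * barrier_dxx k x' r A \<kappa> i j x) (at 0)"
        by (intro DERIV_diff DERIV_cmult D2 bd x \<open>0 < s\<close>)
      show "v z s \<le> v x s"
        using min VQ(1)[OF \<open>x \<in> V\<close>] z(2,3) by blast
    next
      fix i j
      show "continuous_on V (\<lambda>x. D i x s - c * barrier_dx k x' t0 r A \<kappa> i x s)"
        using VQ \<open>r \<noteq> 0\<close> \<open>0 < s\<close>
        by (intro continuous_intros continuous_on_barrier_derivatives
            continuous_on_subset[OF contD VF]) auto
      show "continuous_on V (\<lambda>x. D2 i j x s - c * barrier_dxx k x' r A \<kappa> i j x)"
        using VQ \<open>r \<noteq> 0\<close> \<open>0 < s\<close>
        by (intro continuous_intros continuous_on_barrier_derivatives
            continuous_on_subset[OF contD2 VF]) auto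
    next
      show "(v z has_real_derivative Dt z s - c * (2 / r * z $ k)) (at s)"
        unfolding v_def h_def using \<open>z \<in> V\<close> VF
        by (intro DERIV_diff DERIV_cmult Dt bd \<open>0 < z $ k\<close> \<open>0 < s\<close>) auto
    next
      show "v z s \<le> v z t" if "t0 - r < t" "t < s" for t
        using min[OF z(1), of t] that z(3) by simp
    qed
    also have "\<dots> = ((\<Sum>i\<in>UNIV. \<Sum>j\<in>UNIV. ?a i j * D2 i j z s) - Dt z s)
        - c * ((\<Sum>i\<in>UNIV. \<Sum>j\<in>UNIV. ?a i j * ?b i j) - 2 / r * z $ k)"
      by (simp add: right_diff_distrib sum_subtractf sum_distrib_left mult.left_commute)
    also have "\<dots> = - (c * ((\<Sum>i\<in>UNIV. \<Sum>j\<in>UNIV. ?a i j * ?b i j) - 2 / r * z $ k))"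
      using eq[OF Q_face[OF z(1) \<open>0 < z $ k\<close>] \<open>0 < s\<close>] by simp
    finally have "(\<Sum>i\<in>UNIV. \<Sum>j\<in>UNIV. ?a i j * ?b i j) - 2 / r * z $ k \<le> 0"
      using \<open>0 < c\<close> by (simp add: mult_le_0_iff)
    moreover have "0 < (\<Sum>i\<in>UNIV. \<Sum>j\<in>UNIV. ?a i j * ?b i j) - 2 / r * z $ k"
    proof (rule barrier_strict_subsolution[OF \<kappa>(1) \<open>C > 0\<close> r(1) \<open>0 < z $ k\<close> _ _ _ _ A1 A2])
      show "z $ k \<le> 1" "dist2_along_face k x' z \<le> r\<^sup>2"
        using zk \<delta>(2) r(2) by (auto simp: q_def)
      have "norm z \<le> norm x' + 2"
        using norm_Q[OF z(1)] r(2) norm_triangle_sub[of z x'] by linarith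
      then have "\<bar>K\<bar> * (1 + norm z) \<le> N"
        unfolding N_def by (intro mult_left_mono) auto
      moreover have "K * (1 + norm z) \<le> \<bar>K\<bar> * (1 + norm z)"
        by (intro mult_right_mono) auto
      ultimately show "norm (\<alpha> z (T - s)) \<le> N"
        using K[rule_format, OF Q_orthant[OF z(1)], of "T - s"] \<open>0 < s\<close> by simp
      show "C * z $ k powr (2 - 2 * \<kappa>) \<le> ?a k k"
        using lower[OF Q_orthant[OF z(1)] \<open>0 < z $ k\<close>, of s] \<open>0 < s\<close> \<kappa>(2) by simp
    qed
    ultimately show False
      by simp
  qed

  have "c \<le> 1 / e * (u (x' + e *\<^sub>R axis k 1) t0 - u x' t0)" if "0 < e" "e < \<delta>" for e
  proof -
    have t: "x' + e *\<^sub>R axis k 1 \<in> Q" "(x' + e *\<^sub>R axis k 1) $ k = e" "q (x' + e *\<^sub>R axis k 1) = 0"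
      using tip[of e] that by auto
    \<comment> \<open>On the normal through \<open>P'\<close> at time \<open>t0\<close> the bracket
      equals \<open>1\<close>, and the correction with \<open>A > 0\<close> is nonnegative.\<close>
    have "e \<le> h (x' + e *\<^sub>R axis k 1) t0"
      using t(2,3) A by (simp add: h_def barrier_def q_def)
    then have "c * e \<le> c * h (x' + e *\<^sub>R axis k 1) t0"
      using \<open>0 < c\<close> by simp
    moreover have "0 \<le> v (x' + e *\<^sub>R axis k 1) t0"
      using \<open>0 \<le> v z s\<close> min[OF t(1), of t0] r(1) by simp
    moreover have "face_proj k (x' + e *\<^sub>R axis k 1) = x'"
      using xk by (simp add: vec_eq_iff axis_def)
    ultimately show ?thesis
      using that(1) by (simp add: v_def w_def pos_le_divide_eq)
  qed
  then have "\<forall>\<^sub>F e in at_right 0. ereal c \<le> ereal (1 / e * (u (x' + e *\<^sub>R axis k 1) t0 - u x' t0))"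
    unfolding eventually_at_right_field using \<delta>(1) by auto
  then have "ereal c \<le> Liminf (at_right 0)
      (\<lambda>\<epsilon>. ereal (1 / \<epsilon> * (u (x' + \<epsilon> *\<^sub>R axis k 1) t0 - u x' t0)))"
    by (rule Liminf_bounded)
  moreover have "0 < ereal c"
    using \<open>0 < c\<close> by simp
  ultimately show ?thesis
    by (rule less_le_trans[rotated])
qed

end
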